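(* Let $X$ be a simply connected space with $H^*(X;\mathbb{Q})$ finite-dimensional, and let $N = \max\{n \mid H^n(X;\mathbb{Q}) \ne 0\}$. Let $(\Lambda V, d)$ be the Sullivan minimal model of $X$ and let $x \in V^{2n+1}$ be a Gottlieb element such that $dx$ is a monomial in the generators of $V$. Then $2n+1 < 2N$.
   Context: The Sullivan minimal model $(\Lambda V, d)$ of a simply connected space of finite type is a free graded-commutative DG algebra over $\mathbb{Q}$ on $V = \bigoplus_{n \ge 2} V^n$, each $V^n$ finite-dimensional, with differential $d$ of degree $+1$ whose image lies in the decomposable elements of $\Lambda V$, and $H(\Lambda V,d) \cong H^*(X;\mathbb{Q})$. A derivation of $\Lambda V$ of degree $n$ is a linear map $\theta \colon \Lambda V \to \Lambda V$ lowering degrees by $n$ with $\theta(\chi_1\chi_2) = \theta(\chi_1)\chi_2 + (-1)^{n|\chi_1|}\chi_1\theta(\chi_2)$; it is a derivation cycle if $d\theta - (-1)^n\theta d = 0$. An element $v \in V^n$ is a Gottlieb element if there is a derivation cycle $\theta$ of degree $n$ with $\theta(v) = 1$. "$dx$ is a monomial in the generators of $V$" means: there is a homogeneous basis $u_1, u_2, \ldots$ of $V$, listed in non-strictly increasing order of degrees, such that $dx = w_1 \cdots w_r$ with $w_j = u_{i_j}^{m_j}$, $m_j \ge 1$, $i_1 < i_2 < \cdots < i_r$ (and $m_j = 1$ when $u_{i_j}$ has odd degree). *)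

theory Defs
  imports
    "HOL-Homology.Homology"
    "HOL-Library.Multiset"
    "HOL-Library.Function_Algebras"
    "HOL-Library.Set_Algebras"
begin

section \<open>The free graded-commutative algebra on a graded set of generators\<close>

text \<open>
  A graded rational vector space \<open>V\<close> is given by a homogeneous basis, which is a type of class
  \<open>graded_generators\<close>: \<open>gdeg v\<close> is the degree of the basis vector \<open>v\<close>. The linear order need not
  be related to the degrees; it only selects the normal form (factors in increasing order) of a
  monomial, and hence the signs in the multiplication table.
\<close>

class graded_generators = linorder +
  fixes gdeg :: "'a \<Rightarrow> nat"

text \<open>
  A monomial is a multiset of generators in which odd generators have multiplicity at most one.
\<close>

definition admissible :: "'v::graded_generators multiset \<Rightarrow> bool" where
  "admissible m \<longleftrightarrow> (\<forall>v. odd (gdeg v) \<longrightarrow> count m v \<le> 1)"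

definition mdeg :: "'v::graded_generators multiset \<Rightarrow> nat" where
  "mdeg m = (\<Sum>v\<in>#m. gdeg v)"

text \<open>
  Multiplying the normal forms of \<open>a\<close> and \<open>b\<close> yields \<open>koszul_sign a b\<close> times the normal form of
  \<open>a + b\<close>: a sign for every pair of odd factors that has to be interchanged, and zero if an odd
  factor is repeated.
\<close>

definition inversions :: "'v::graded_generators multiset \<Rightarrow> 'v multiset \<Rightarrow> ('v \<times> 'v) set" where
  "inversions a b = {(v, w). v \<in># a \<and> w \<in># b \<and> odd (gdeg v) \<and> odd (gdeg w) \<and> w < v}"

definition koszul_sign :: "'v::graded_generators multiset \<Rightarrow> 'v multiset \<Rightarrow> rat" where
  "koszul_sign a b = (if admissible (a + b) then (-1) ^ card (inversions a b) else 0)"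

text \<open>
  \<open>'v free_gca\<close> is \<open>\<Lambda>V\<close>, i.e. the symmetric algebra on \<open>V\<^sup>e\<^sup>v\<^sup>e\<^sup>n\<close> tensored with the exterior
  algebra on \<open>V\<^sup>o\<^sup>d\<^sup>d\<close>.
\<close>

typedef (overloaded) 'v free_gca =
  "{f :: 'v::graded_generators multiset \<Rightarrow> rat.
      finite {m. f m \<noteq> 0} \<and> (\<forall>m. f m \<noteq> 0 \<longrightarrow> admissible m)}"
  morphisms mcoeff Abs_free_gca
  by (rule exI[of _ "\<lambda>_. 0"]) simp

setup_lifting type_definition_free_gca

lemma finite_submultisets: "finite {a. a \<subseteq># (m :: 'b multiset)}"
proof (induction m)
  case (add x m)
  have "{a. a \<subseteq># add_mset x m} \<subseteq> {a. a \<subseteq># m} \<union> add_mset x ` {a. a \<subseteq># m}"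
  proof
    fix a assume "a \<in> {a. a \<subseteq># add_mset x m}"
    then have a: "a \<subseteq># add_mset x m" by simp
    show "a \<in> {a. a \<subseteq># m} \<union> add_mset x ` {a. a \<subseteq># m}"
    proof (cases "x \<in># a")
      case True
      then obtain b where "a = add_mset x b" by (meson mset_add)
      with a show ?thesis by auto
    next
      case False
      with a show ?thesis by (auto simp: subseteq_mset_def not_in_iff split: if_splits)
          (metis not_in_iff le0 nle_le)
    qed
  qed
  with add show ?case by (meson finite_UnI finite_imageI finite_subset)
qed simp

instantiation free_gca :: (graded_generators) ring_1
begin

lift_definition zero_free_gca :: "'a free_gca" is "\<lambda>_. 0" by simp

lift_definition one_free_gca :: "'a free_gca" is "\<lambda>m. if m = {#} then 1 else 0"
  by (auto simp: admissible_def)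

lift_definition plus_free_gca :: "'a free_gca \<Rightarrow> 'a free_gca \<Rightarrow> 'a free_gca"
  is "\<lambda>f g m. f m + g m"
proof -
  fix f g :: "'a multiset \<Rightarrow> rat"
  assume f: "finite {m. f m \<noteq> 0} \<and> (\<forall>m. f m \<noteq> 0 \<longrightarrow> admissible m)"
    and g: "finite {m. g m \<noteq> 0} \<and> (\<forall>m. g m \<noteq> 0 \<longrightarrow> admissible m)"
  have "{m. f m + g m \<noteq> 0} \<subseteq> {m. f m \<noteq> 0} \<union> {m. g m \<noteq> 0}" by auto
  with f g show "finite {m. f m + g m \<noteq> 0} \<and> (\<forall>m. f m + g m \<noteq> 0 \<longrightarrow> admissible m)"
    by (metis (mono_tags, lifting) add_0 finite_UnI finite_subset)
qed

lift_definition uminus_free_gca :: "'a free_gca \<Rightarrow> 'a free_gca" is "\<lambda>f m. - f m" by simp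

definition minus_free_gca :: "'a free_gca \<Rightarrow> 'a free_gca \<Rightarrow> 'a free_gca" where
  "minus_free_gca a b = a + - b"

lift_definition times_free_gca :: "'a free_gca \<Rightarrow> 'a free_gca \<Rightarrow> 'a free_gca"
  is "\<lambda>f g m. \<Sum>a | a \<subseteq># m. koszul_sign a (m - a) * f a * g (m - a)"
proof -
  fix f g :: "'a multiset \<Rightarrow> rat"
  assume f: "finite {m. f m \<noteq> 0} \<and> (\<forall>m. f m \<noteq> 0 \<longrightarrow> admissible m)"
    and g: "finite {m. g m \<noteq> 0} \<and> (\<forall>m. g m \<noteq> 0 \<longrightarrow> admissible m)"
  let ?h = "\<lambda>m. \<Sum>a | a \<subseteq># m. koszul_sign a (m - a) * f a * g (m - a)"
  have nz: "\<exists>a. a \<subseteq># m \<and> koszul_sign a (m - a) \<noteq> 0 \<and> f a \<noteq> 0 \<and> g (m - a) \<noteq> 0"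
    if "?h m \<noteq> 0" for m
    using sum.not_neutral_contains_not_neutral[OF that] by auto
  have "{m. ?h m \<noteq> 0} \<subseteq> (\<lambda>(a, b). a + b) ` ({m. f m \<noteq> 0} \<times> {m. g m \<noteq> 0})"
  proof
    fix m assume "m \<in> {m. ?h m \<noteq> 0}"
    then obtain a where "a \<subseteq># m" "f a \<noteq> 0" "g (m - a) \<noteq> 0" using nz by blast
    then show "m \<in> (\<lambda>(a, b). a + b) ` ({m. f m \<noteq> 0} \<times> {m. g m \<noteq> 0})"
      by (intro image_eqI[of _ _ "(a, m - a)"]) auto
  qed
  then have "finite {m. ?h m \<noteq> 0}"
    using f g by (meson finite_SigmaI finite_imageI finite_subset)
  moreover have "admissible m" if "?h m \<noteq> 0" for m
    using nz[OF that] by (auto simp: koszul_sign_def split: if_splits)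
  ultimately show "finite {m. ?h m \<noteq> 0} \<and> (\<forall>m. ?h m \<noteq> 0 \<longrightarrow> admissible m)" by blast
qed

lemma koszul_sign_cocycle:
  fixes a b c :: "'a multiset"
  shows "koszul_sign (a + b) c * koszul_sign a b = koszul_sign a (b + c) * koszul_sign b c"
proof (cases "admissible (a + b + c)")
  case True
  have fin: "finite (inversions x y)" for x y :: "'a multiset"
    by (rule finite_subset[of _ "set_mset x \<times> set_mset y"]) (auto simp: inversions_def)
  have sub: "admissible (a + b)" "admissible (b + c)"
    using True unfolding admissible_def by (metis add_leD1 count_union, metis add.assoc add_leD2 count_union)
  have once: "\<not> (v \<in># x \<and> v \<in># y)" if "odd (gdeg v)" "admissible (x + y)" for v and x y :: "'a multiset"
  proof
    assume "v \<in># x \<and> v \<in># y"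
    then have "count x v \<ge> 1" "count y v \<ge> 1" by auto
    moreover have "count x v + count y v \<le> 1" using that by (auto simp: admissible_def)
    ultimately show False by linarith
  qed
  have "inversions (a + b) c = inversions a c \<union> inversions b c"
    by (auto simp: inversions_def)
  moreover have "inversions a c \<inter> inversions b c = {}"
    using once[OF _ sub(1)] by (auto simp: inversions_def)
  ultimately have 1: "card (inversions (a + b) c) = card (inversions a c) + card (inversions b c)"
    by (simp add: card_Un_disjoint fin)
  have "inversions a (b + c) = inversions a b \<union> inversions a c"
    by (auto simp: inversions_def)
  moreover have "inversions a b \<inter> inversions a c = {}"
    using once[OF _ sub(2)] by (auto simp: inversions_def)
  ultimately have 2: "card (inversions a (b + c)) = card (inversions a b) + card (inversions a c)"
    by (simp add: card_Un_disjoint fin)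
  show ?thesis using True sub by (simp add: koszul_sign_def 1 2 power_add add.assoc)
next
  case False
  then show ?thesis by (simp add: koszul_sign_def add.assoc)
qed

instance
proof
  fix a b c :: "'a free_gca"
  show "a + b + c = a + (b + c)" by transfer (simp add: add.assoc)
  show "a + b = b + a" by transfer (simp add: add.commute)
  show "0 + a = a" by transfer simp
  show "- a + a = 0" by transfer simp
  show "a - b = a + - b" by (simp add: minus_free_gca_def)
  show "(0::'a free_gca) \<noteq> 1" by transfer (metis zero_neq_one)
  show "(a + b) * c = a * c + b * c"
    by transfer (simp add: algebra_simps sum.distrib)
  show "a * (b + c) = a * b + a * c"
    by transfer (simp add: algebra_simps sum.distrib)
  show "1 * a = a"
  proof transfer
    fix f :: "'a multiset \<Rightarrow> rat"
    assume f: "finite {m. f m \<noteq> 0} \<and> (\<forall>m. f m \<noteq> 0 \<longrightarrow> admissible m)"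
    have "(\<Sum>a | a \<subseteq># m. koszul_sign a (m - a) * (if a = {#} then 1 else 0) * f (m - a)) = f m" for m
    proof -
      have "(\<Sum>a | a \<subseteq># m. koszul_sign a (m - a) * (if a = {#} then 1 else 0) * f (m - a))
          = (\<Sum>a \<in> {{#}}. koszul_sign a (m - a) * (if a = {#} then 1 else 0) * f (m - a))"
        by (rule sum.mono_neutral_right) (auto simp: finite_submultisets)
      then show ?thesis using f by (auto simp: koszul_sign_def inversions_def)
    qed
    then show "(\<lambda>m. \<Sum>a | a \<subseteq># m. koszul_sign a (m - a) * (if a = {#} then 1 else 0) * f (m - a)) = f"
      by blast
  qed
  show "a * 1 = a"
  proof transfer
    fix f :: "'a multiset \<Rightarrow> rat"
    assume f: "finite {m. f m \<noteq> 0} \<and> (\<forall>m. f m \<noteq> 0 \<longrightarrow> admissible m)"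
    have "(\<Sum>a | a \<subseteq># m. koszul_sign a (m - a) * f a * (if m - a = {#} then 1 else 0)) = f m" for m
    proof -
      have "(\<Sum>a | a \<subseteq># m. koszul_sign a (m - a) * f a * (if m - a = {#} then 1 else 0))
          = (\<Sum>a \<in> {m}. koszul_sign a (m - a) * f a * (if m - a = {#} then 1 else 0))"
        by (rule sum.mono_neutral_right)
          (auto simp: finite_submultisets Diff_eq_empty_iff_mset subset_mset.antisym)
      then show ?thesis using f by (auto simp: koszul_sign_def inversions_def)
    qed
    then show "(\<lambda>m. \<Sum>a | a \<subseteq># m. koszul_sign a (m - a) * f a * (if m - a = {#} then 1 else 0)) = f"
      by blast
  qed
  show "a * b * c = a * (b * c)"
  proof transfer
    fix f g h :: "'a multiset \<Rightarrow> rat"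
    have "(\<Sum>e | e \<subseteq># m. koszul_sign e (m - e) *
              (\<Sum>a | a \<subseteq># e. koszul_sign a (e - a) * f a * g (e - a)) * h (m - e))
        = (\<Sum>a | a \<subseteq># m. koszul_sign a (m - a) * f a *
              (\<Sum>b | b \<subseteq># m - a. koszul_sign b (m - a - b) * g b * h (m - a - b)))" for m
    proof -
      let ?L = "\<lambda>(e, a). koszul_sign e (m - e) * (koszul_sign a (e - a) * f a * g (e - a)) * h (m - e)"
      let ?R = "\<lambda>(a, b). koszul_sign a (m - a) * f a * (koszul_sign b (m - a - b) * g b * h (m - a - b))"
      have "(\<Sum>e | e \<subseteq># m. koszul_sign e (m - e) *
              (\<Sum>a | a \<subseteq># e. koszul_sign a (e - a) * f a * g (e - a)) * h (m - e))
          = sum ?L (SIGMA e:{e. e \<subseteq># m}. {a. a \<subseteq># e})"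
        by (simp add: sum_distrib_left sum_distrib_right sum.Sigma finite_submultisets)
      also have "\<dots> = sum ?R (SIGMA a:{a. a \<subseteq># m}. {b. b \<subseteq># m - a})"
      proof (rule sum.reindex_bij_witness
          [where i = "\<lambda>(a, b). (a + b, a)" and j = "\<lambda>(e, a). (a, e - a)"])
        fix p assume "p \<in> (SIGMA e:{e. e \<subseteq># m}. {a. a \<subseteq># e})"
        then obtain e a where p: "p = (e, a)" and em: "e \<subseteq># m" and ae: "a \<subseteq># e" by auto
        obtain b where e: "e = a + b" using ae by (auto simp: mset_subset_eq_exists_conv)
        obtain c where m: "m = a + b + c" using em e by (auto simp: mset_subset_eq_exists_conv)
        show "(case case p of (e, a) \<Rightarrow> (a, e - a) of (a, b) \<Rightarrow> (a + b, a)) = p"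
          by (simp add: p e)
        show "(case p of (e, a) \<Rightarrow> (a, e - a)) \<in> (SIGMA a:{a. a \<subseteq># m}. {b. b \<subseteq># m - a})"
          by (simp add: p e m add.assoc)
        have "m - a = b + c" "m - e = c" "m - a - b = c" "e - a = b" by (simp_all add: m e add.assoc)
        with koszul_sign_cocycle[of a b c]
        show "?R (case p of (e, a) \<Rightarrow> (a, e - a)) = ?L p"
          by (simp add: p e algebra_simps)
      next
        fix p assume "p \<in> (SIGMA a:{a. a \<subseteq># m}. {b. b \<subseteq># m - a})"
        then obtain a b where p: "p = (a, b)" and am: "a \<subseteq># m" and bm: "b \<subseteq># m - a" by auto
        show "(case case p of (a, b) \<Rightarrow> (a + b, a) of (e, a) \<Rightarrow> (a, e - a)) = p"
          by (simp add: p)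
        show "(case p of (a, b) \<Rightarrow> (a + b, a)) \<in> (SIGMA e:{e. e \<subseteq># m}. {a. a \<subseteq># e})"
          using am bm by (simp add: p subset_mset.le_diff_conv2 add.commute)
      qed
      also have "\<dots> = (\<Sum>a | a \<subseteq># m. koszul_sign a (m - a) * f a *
              (\<Sum>b | b \<subseteq># m - a. koszul_sign b (m - a - b) * g b * h (m - a - b)))"
        by (simp add: sum_distrib_left sum.Sigma finite_submultisets)
      finally show ?thesis .
    qed
    then show "(\<lambda>m. \<Sum>e | e \<subseteq># m. koszul_sign e (m - e) *
              (\<Sum>a | a \<subseteq># e. koszul_sign a (e - a) * f a * g (e - a)) * h (m - e))
        = (\<lambda>m. \<Sum>a | a \<subseteq># m. koszul_sign a (m - a) * f a *
              (\<Sum>b | b \<subseteq># m - a. koszul_sign b (m - a - b) * g b * h (m - a - b)))"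
      by blast
  qed
qed

end

lift_definition qscale :: "rat \<Rightarrow> 'v::graded_generators free_gca \<Rightarrow> 'v free_gca" (infixr \<open>*\<^sub>Q\<close> 75)
  is "\<lambda>q f m. q * f m"
proof -
  fix q :: rat and f :: "'v multiset \<Rightarrow> rat"
  assume f: "finite {m. f m \<noteq> 0} \<and> (\<forall>m. f m \<noteq> 0 \<longrightarrow> admissible m)"
  have "{m. q * f m \<noteq> 0} \<subseteq> {m. f m \<noteq> 0}" by auto
  with f show "finite {m. q * f m \<noteq> 0} \<and> (\<forall>m. q * f m \<noteq> 0 \<longrightarrow> admissible m)"
    by (auto intro: finite_subset)
qed

global_interpretation gca: vector_space "qscale :: rat \<Rightarrow> 'v::graded_generators free_gca \<Rightarrow> 'v free_gca"
proof
  fix q r :: rat and a b :: "'v free_gca"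
  show "q *\<^sub>Q (a + b) = q *\<^sub>Q a + q *\<^sub>Q b" by transfer (simp add: algebra_simps)
  show "(q + r) *\<^sub>Q a = q *\<^sub>Q a + r *\<^sub>Q a" by transfer (simp add: algebra_simps)
  show "q *\<^sub>Q r *\<^sub>Q a = (q * r) *\<^sub>Q a" by transfer (simp add: mult.assoc)
  show "1 *\<^sub>Q a = a" by transfer simp
qed

lemma qscale_mult_left: "(q *\<^sub>Q a) * b = q *\<^sub>Q (a * b)"
  by transfer (simp add: sum_distrib_left algebra_simps)

lemma qscale_mult_right: "a * (q *\<^sub>Q b) = q *\<^sub>Q (a * b)"
  by transfer (simp add: sum_distrib_left algebra_simps)

definition grade :: "nat \<Rightarrow> 'v::graded_generators free_gca set" where
  "grade n = {a. \<forall>m. mcoeff a m \<noteq> 0 \<longrightarrow> mdeg m = n}"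

lift_definition gen :: "'v::graded_generators \<Rightarrow> 'v free_gca"
  is "\<lambda>v m. if m = {#v#} then 1 else 0"
  by (auto simp: admissible_def)

lemma koszul_sign_swap:
  fixes a b :: "'v::graded_generators multiset"
  shows "koszul_sign a b = (-1) ^ (mdeg a * mdeg b) * koszul_sign b a"
proof (cases "admissible (a + b)")
  case True
  define odds :: "'v multiset \<Rightarrow> 'v set" where "odds m = {v. v \<in># m \<and> odd (gdeg v)}" for m
  have fin: "finite (odds m)" for m by (simp add: odds_def)
  have parity: "even (mdeg m) \<longleftrightarrow> even (card (odds m))" if "admissible m" for m
    using that
  proof (induction m)
    case (add v m)
    have m: "admissible m" using add.prems unfolding admissible_def
      by (metis count_add_mset le_Suc_eq le_refl nat_le_linear not_less_eq_eq order_trans)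
    show ?case
    proof (cases "odd (gdeg v)")
      case True
      then have "count (add_mset v m) v \<le> 1" using add.prems unfolding admissible_def by blast
      then have "v \<notin> odds m" by (simp add: odds_def not_in_iff)
      moreover have "odds (add_mset v m) = insert v (odds m)" using True by (auto simp: odds_def)
      ultimately show ?thesis using add.IH[OF m] True by (simp add: mdeg_def fin)
    next
      case False
      then have "odds (add_mset v m) = odds m" by (auto simp: odds_def)
      then show ?thesis using add.IH[OF m] False by (simp add: mdeg_def)
    qed
  qed (simp add: mdeg_def odds_def)
  have adm: "admissible a" "admissible b"
    using True unfolding admissible_def by (metis add_leD1 count_union, metis add_leD2 count_union)
  have disj: "odds a \<inter> odds b = {}"
  proof (rule ccontr)
    assume "odds a \<inter> odds b \<noteq> {}"
    then obtain v where v: "v \<in># a" "v \<in># b" "odd (gdeg v)" by (auto simp: odds_def)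
    then have "count a v \<ge> 1" "count b v \<ge> 1" by auto
    moreover have "count a v + count b v \<le> 1" using True v(3) by (auto simp: admissible_def)
    ultimately show False by linarith
  qed
  have "odds a \<times> odds b = inversions a b \<union> prod.swap ` inversions b a"
    using disj by (auto simp: odds_def inversions_def image_iff)
  moreover have "inversions a b \<inter> prod.swap ` inversions b a = {}"
    by (auto simp: inversions_def)
  moreover have "finite (inversions a b)" "finite (inversions b a)"
    by (rule finite_subset[of _ "odds a \<times> odds b"] finite_subset[of _ "odds b \<times> odds a"],
        auto simp: inversions_def odds_def)+
  ultimately have "card (odds a) * card (odds b) = card (inversions a b) + card (inversions b a)"
    by (metis card_Un_disjoint card_cartesian_product card_image finite_imageI inj_swap)
  then have "even (card (inversions a b)) \<longleftrightarrow> even (mdeg a * mdeg b + card (inversions b a))"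
    using parity[OF adm(1)] parity[OF adm(2)] by (metis even_add even_mult_iff)
  then have "(-1 :: rat) ^ card (inversions a b) = (-1) ^ (mdeg a * mdeg b + card (inversions b a))"
    by (metis neg_one_even_power neg_one_odd_power)
  then show ?thesis using True by (simp add: koszul_sign_def power_add add.commute)
qed (simp add: koszul_sign_def add.commute)

lemma neg_one_power_mult: "(-1) ^ k * a = ((-1) ^ k :: rat) *\<^sub>Q (a :: 'v::graded_generators free_gca)"
  by (cases "even k") simp_all

lemma graded_commutative:
  fixes a b :: "'v::graded_generators free_gca"
  assumes "a \<in> grade p" "b \<in> grade q"
  shows "a * b = (-1) ^ (p * q) * (b * a)"
proof -
  have a: "mcoeff a m \<noteq> 0 \<Longrightarrow> mdeg m = p" and b: "mcoeff b m \<noteq> 0 \<Longrightarrow> mdeg m = q" for m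
    using assms by (auto simp: grade_def)
  have "mcoeff (a * b) m = mcoeff ((-1) ^ (p * q) *\<^sub>Q (b * a)) m" for m
  proof -
    have dd: "m - (m - c) = c" if "c \<subseteq># m" for c
      using that by (auto simp: subseteq_mset_def multiset_eq_iff)
    have "mcoeff (a * b) m
        = (\<Sum>c | c \<subseteq># m. koszul_sign c (m - c) * mcoeff a c * mcoeff b (m - c))"
      by (simp add: times_free_gca.rep_eq)
    also have "\<dots> = (\<Sum>c | c \<subseteq># m. koszul_sign (m - c) c * mcoeff a (m - c) * mcoeff b c)"
      by (rule sum.reindex_bij_witness[where i = "\<lambda>c. m - c" and j = "\<lambda>c. m - c"])
        (auto simp: dd)
    also have "\<dots> = (\<Sum>c | c \<subseteq># m.
        (-1) ^ (p * q) * (koszul_sign c (m - c) * mcoeff b c * mcoeff a (m - c)))"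
    proof (rule sum.cong[OF refl])
      fix c
      show "koszul_sign (m - c) c * mcoeff a (m - c) * mcoeff b c
          = (-1) ^ (p * q) * (koszul_sign c (m - c) * mcoeff b c * mcoeff a (m - c))"
      proof (cases "mcoeff a (m - c) = 0 \<or> mcoeff b c = 0")
        case False
        then have "mdeg (m - c) = p" "mdeg c = q" using a b by auto
        then show ?thesis using koszul_sign_swap[of "m - c" c] by simp
      qed auto
    qed
    finally show ?thesis
      by (simp add: times_free_gca.rep_eq qscale.rep_eq sum_distrib_left)
  qed
  then show ?thesis by (simp add: neg_one_power_mult mcoeff_inject[symmetric] fun_eq_iff)
qed

definition V_all :: "'v::graded_generators free_gca set" where
  "V_all = gca.span (range gen)"

definition V_deg :: "nat \<Rightarrow> 'v::graded_generators free_gca set" where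
  "V_deg n = gca.span (gen ` {v. gdeg v = n})"

definition decomposables :: "'v::graded_generators free_gca set" where
  "decomposables = gca.span {a * b | a b i j. a \<in> grade i \<and> b \<in> grade j \<and> 0 < i \<and> 0 < j}"


section \<open>Minimal Sullivan algebras, derivations and Gottlieb elements\<close>

text \<open>
  For generators of degree at least two, decomposability of the differential already implies the
  nilpotence condition of a Sullivan algebra.
\<close>

definition minimal_sullivan_algebra ::
  "('v::graded_generators free_gca \<Rightarrow> 'v free_gca) \<Rightarrow> bool" where
  "minimal_sullivan_algebra d \<longleftrightarrow>
     (\<forall>v::'v. 2 \<le> gdeg v) \<and>
     (\<forall>n. finite {v::'v. gdeg v = n}) \<and>
     Vector_Spaces.linear (*\<^sub>Q) (*\<^sub>Q) d \<and>
     (\<forall>k. \<forall>a\<in>grade k. d a \<in> grade (k + 1)) \<and>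
     (\<forall>k. \<forall>a\<in>grade k. \<forall>b. d (a * b) = d a * b + (-1) ^ k * (a * d b)) \<and>
     (\<forall>a. d (d a) = 0) \<and>
     (\<forall>a. d a \<in> decomposables)"

definition derivation ::
  "nat \<Rightarrow> ('v::graded_generators free_gca \<Rightarrow> 'v free_gca) \<Rightarrow> bool" where
  "derivation n \<theta> \<longleftrightarrow>
     Vector_Spaces.linear (*\<^sub>Q) (*\<^sub>Q) \<theta> \<and>
     (\<forall>k. \<forall>a\<in>grade (k + n). \<theta> a \<in> grade k) \<and>
     (\<forall>k<n. \<forall>a\<in>grade k. \<theta> a = 0) \<and>
     (\<forall>k. \<forall>a\<in>grade k. \<forall>b. \<theta> (a * b) = \<theta> a * b + (-1) ^ (n * k) * (a * \<theta> b))"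

definition derivation_cycle ::
  "('v::graded_generators free_gca \<Rightarrow> 'v free_gca) \<Rightarrow> nat \<Rightarrow> ('v free_gca \<Rightarrow> 'v free_gca) \<Rightarrow> bool" where
  "derivation_cycle d n \<theta> \<longleftrightarrow>
     derivation n \<theta> \<and> (\<forall>a. d (\<theta> a) - (-1) ^ n * \<theta> (d a) = 0)"

definition gottlieb_element ::
  "('v::graded_generators free_gca \<Rightarrow> 'v free_gca) \<Rightarrow> nat \<Rightarrow> 'v free_gca \<Rightarrow> bool" where
  "gottlieb_element d n v \<longleftrightarrow> v \<in> V_deg n \<and> (\<exists>\<theta>. derivation_cycle d n \<theta> \<and> \<theta> v = 1)"

text \<open>
  The basis vectors \<open>u i\<close> have degree \<open>e i\<close> and are indexed by \<open>I\<close>, which is an initial segment of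
  the natural numbers (all of them if \<open>V\<close> is infinite-dimensional).
\<close>

definition ordered_homogeneous_basis ::
  "nat set \<Rightarrow> (nat \<Rightarrow> nat) \<Rightarrow> (nat \<Rightarrow> 'v::graded_generators free_gca) \<Rightarrow> bool" where
  "ordered_homogeneous_basis I e u \<longleftrightarrow>
     (I = UNIV \<or> (\<exists>k. I = {..<k})) \<and>
     inj_on u I \<and> gca.independent (u ` I) \<and> gca.span (u ` I) = V_all \<and>
     (\<forall>i\<in>I. u i \<in> V_deg (e i)) \<and>
     mono_on I e"

definition monomial_in_generators :: "'v::graded_generators free_gca \<Rightarrow> bool" where
  "monomial_in_generators y \<longleftrightarrow>
     (\<exists>I e u is m.
        ordered_homogeneous_basis I e u \<and>
        is \<noteq> [] \<and> set is \<subseteq> I \<and> sorted_wrt (<) is \<and>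
        (\<forall>i\<in>set is. 1 \<le> m i \<and> (odd (e i) \<longrightarrow> m i = 1)) \<and>
        y = prod_list (map (\<lambda>i. u i ^ m i) is))"


section \<open>Rational singular cohomology\<close>

text \<open>
  Cochains are functions on singular simplices, extended by zero to all other functions.
\<close>

type_synonym 'a cochain = "((nat \<Rightarrow> real) \<Rightarrow> 'a) \<Rightarrow> rat"

definition cochains :: "nat \<Rightarrow> 'a topology \<Rightarrow> 'a cochain set" where
  "cochains n X = {c. \<forall>s. \<not> singular_simplex n X s \<longrightarrow> c s = 0}"

definition cobd :: "nat \<Rightarrow> 'a topology \<Rightarrow> 'a cochain \<Rightarrow> 'a cochain" where
  "cobd n X c = (\<lambda>s. if singular_simplex (Suc n) X s
                     then \<Sum>k\<le>Suc n. (-1) ^ k * c (singular_face (Suc n) k s) else 0)"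

definition cocycles :: "nat \<Rightarrow> 'a topology \<Rightarrow> 'a cochain set" where
  "cocycles n X = {c \<in> cochains n X. cobd n X c = 0}"

definition coboundaries :: "nat \<Rightarrow> 'a topology \<Rightarrow> 'a cochain set" where
  "coboundaries n X = (case n of 0 \<Rightarrow> {0} | Suc k \<Rightarrow> cobd k X ` cochains k X)"

definition cohomology :: "nat \<Rightarrow> 'a topology \<Rightarrow> 'a cochain set set" where
  "cohomology n X = (\<lambda>c. c +o coboundaries n X) ` cocycles n X"

text \<open>
  The cup product evaluates \<open>c\<close> on the front \<open>p\<close>-face and \<open>c'\<close> on the back \<open>q\<close>-face.
\<close>

definition front_face :: "nat \<Rightarrow> ((nat \<Rightarrow> real) \<Rightarrow> 'a) \<Rightarrow> (nat \<Rightarrow> real) \<Rightarrow> 'a" where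
  "front_face p s = restrict s (standard_simplex p)"

definition back_face :: "nat \<Rightarrow> nat \<Rightarrow> ((nat \<Rightarrow> real) \<Rightarrow> 'a) \<Rightarrow> (nat \<Rightarrow> real) \<Rightarrow> 'a" where
  "back_face p q s = restrict (\<lambda>t. s (\<lambda>i. if i < p then 0 else t (i - p))) (standard_simplex q)"

definition cup :: "nat \<Rightarrow> nat \<Rightarrow> 'a topology \<Rightarrow> 'a cochain \<Rightarrow> 'a cochain \<Rightarrow> 'a cochain" where
  "cup p q X c c' = (\<lambda>s. if singular_simplex (p + q) X s
                         then c (front_face p s) * c' (back_face p q s) else 0)"

definition unit_cochain :: "'a topology \<Rightarrow> 'a cochain" where
  "unit_cochain X = (\<lambda>s. if singular_simplex 0 X s then 1 else 0)"

definition nonzero_cohomology :: "nat \<Rightarrow> 'a topology \<Rightarrow> bool" where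
  "nonzero_cohomology n X \<longleftrightarrow> cohomology n X \<noteq> {coboundaries n X}"

definition finite_dimensional_cohomology :: "'a topology \<Rightarrow> bool" where
  "finite_dimensional_cohomology X \<longleftrightarrow>
     finite {n. nonzero_cohomology n X} \<and>
     (\<forall>n. \<exists>S \<subseteq> cocycles n X. finite S \<and>
        (\<forall>z \<in> cocycles n X. \<exists>q. z \<in> (\<lambda>s. \<Sum>c\<in>S. q c * c s) +o coboundaries n X))"


section \<open>Minimal models of simply connected spaces\<close>

text \<open>
  The library's \<open>simply_connected\<close> is restricted to subsets of topological spaces given by a type
  class; this is the notion for abstract topologies.
\<close>

definition simply_connected_space :: "'a topology \<Rightarrow> bool" where
  "simply_connected_space X \<longleftrightarrow>
     topspace X \<noteq> {} \<and> path_connected_space X \<and>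
     (\<forall>g x. pathin X g \<and> g 0 = x \<and> g 1 = x \<longrightarrow>
        homotopic_with (\<lambda>h. h 0 = x \<and> h 1 = x) (top_of_set {0..1}) X g (\<lambda>_. x))"

definition dga_cocycles ::
  "('v::graded_generators free_gca \<Rightarrow> 'v free_gca) \<Rightarrow> nat \<Rightarrow> 'v free_gca set" where
  "dga_cocycles d n = {a \<in> grade n. d a = 0}"

definition dga_coboundaries ::
  "('v::graded_generators free_gca \<Rightarrow> 'v free_gca) \<Rightarrow> nat \<Rightarrow> 'v free_gca set" where
  "dga_coboundaries d n = (case n of 0 \<Rightarrow> {0} | Suc k \<Rightarrow> d ` grade k)"

definition dga_class ::
  "('v::graded_generators free_gca \<Rightarrow> 'v free_gca) \<Rightarrow> nat \<Rightarrow> 'v free_gca \<Rightarrow> 'v free_gca set" where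
  "dga_class d n a = a +o dga_coboundaries d n"

definition dga_cohomology ::
  "('v::graded_generators free_gca \<Rightarrow> 'v free_gca) \<Rightarrow> nat \<Rightarrow> 'v free_gca set set" where
  "dga_cohomology d n = dga_class d n ` dga_cocycles d n"

text \<open>
  An isomorphism of graded algebras from \<open>H(\<Lambda>V, d)\<close> to \<open>H\<^sup>*(X; \<rat>)\<close>. Both sides consist of cosets,
  and the algebra operations are those induced on representatives.
\<close>

definition cohomology_iso ::
  "('v::graded_generators free_gca \<Rightarrow> 'v free_gca) \<Rightarrow> 'a topology \<Rightarrow>
   (nat \<Rightarrow> 'v free_gca set \<Rightarrow> 'a cochain set) \<Rightarrow> bool" where
  "cohomology_iso d X \<Phi> \<longleftrightarrow>
     (\<forall>n. bij_betw (\<Phi> n) (dga_cohomology d n) (cohomology n X)) \<and>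
     (\<forall>n. \<forall>a\<in>dga_cocycles d n. \<forall>b\<in>dga_cocycles d n.
        \<forall>c\<in>\<Phi> n (dga_class d n a). \<forall>c'\<in>\<Phi> n (dga_class d n b).
          c + c' \<in> \<Phi> n (dga_class d n (a + b))) \<and>
     (\<forall>n. \<forall>a\<in>dga_cocycles d n. \<forall>q. \<forall>c\<in>\<Phi> n (dga_class d n a).
          (\<lambda>s. q * c s) \<in> \<Phi> n (dga_class d n (q *\<^sub>Q a))) \<and>
     (\<forall>p q. \<forall>a\<in>dga_cocycles d p. \<forall>b\<in>dga_cocycles d q.
        \<forall>c\<in>\<Phi> p (dga_class d p a). \<forall>c'\<in>\<Phi> q (dga_class d q b).
          cup p q X c c' \<in> \<Phi> (p + q) (dga_class d (p + q) (a * b))) \<and>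
     unit_cochain X \<in> \<Phi> 0 (dga_class d 0 1)"

text \<open>
  The quasi-isomorphism between \<open>(\<Lambda>V, d)\<close> and the polynomial forms on \<open>X\<close> enters only through the
  isomorphism it induces in cohomology. Every Sullivan minimal model of \<open>X\<close> therefore satisfies the
  following predicate, and results proved from it apply to the minimal model of \<open>X\<close>.
\<close>

definition sullivan_minimal_model ::
  "('v::graded_generators free_gca \<Rightarrow> 'v free_gca) \<Rightarrow> 'a topology \<Rightarrow> bool" where
  "sullivan_minimal_model d X \<longleftrightarrow>
     minimal_sullivan_algebra d \<and> (\<exists>\<Phi>. cohomology_iso d X \<Phi>)"

end

theory Submission
  imports Defs
begin

text \<open>
  Suppose \<open>H\<^sup>k = 0\<close> for all \<open>k > n\<close>. A derivation cycle \<open>\<theta>\<close> of degree \<open>2n + 1\<close> vanishes on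
  coboundaries of that degree, so no cocycle \<open>c\<close> of degree \<open>2n + 1\<close> can have \<open>\<theta> c = 1\<close>; from \<open>x\<close>
  one constructs such a cocycle.

  Let \<open>u\<close> be the first generator in the monomial and \<open>dx = u p\<close>. Then \<open>du = 0\<close>. If \<open>u\<close> has even
  degree, it is a nonzero divisor, so \<open>dp = 0\<close>; one of \<open>u\<close>, \<open>p\<close> has degree above \<open>n\<close> and is
  therefore exact, so \<open>dx\<close> is the differential of a product \<open>c\<close> of two elements of positive degree,
  and \<open>x - c\<close> is the required cocycle.

  If \<open>u\<close> has odd degree, then \<open>x u\<close> is a cocycle, hence exact, and successive corrections solve
  \<open>dz = x u p = x dx\<close> with \<open>z\<close> a sum of products of elements of smaller degree. Thus \<open>\<theta> (\<theta> z) = 0\<close>, while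
  \<open>d (\<theta> z) = - \<theta> (x dx) = - dx\<close>, so \<open>x + \<theta> z\<close> is the required cocycle.
\<close>

section \<open>Grading and partial derivatives\<close>

lemma linear_gca_iff:
  "Vector_Spaces.linear (*\<^sub>Q) (*\<^sub>Q) f \<longleftrightarrow>
    (\<forall>a b. f (a + b) = f a + f b) \<and> (\<forall>q a. f (q *\<^sub>Q a) = q *\<^sub>Q f a)"
  for f :: "'v::graded_generators free_gca \<Rightarrow> 'v free_gca"
  using gca.vector_space_axioms by (auto simp: Vector_Spaces.linear_iff)

lemma linear_gca_zero:
  fixes f :: "'v::graded_generators free_gca \<Rightarrow> 'v free_gca"
  assumes "Vector_Spaces.linear (*\<^sub>Q) (*\<^sub>Q) f" shows "f 0 = 0"
  using assms unfolding linear_gca_iff by (metis gca.scale_zero_left)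

lemma linear_gca_uminus:
  fixes f :: "'v::graded_generators free_gca \<Rightarrow> 'v free_gca"
  assumes "Vector_Spaces.linear (*\<^sub>Q) (*\<^sub>Q) f" shows "f (- a) = - f a"
  using assms linear_gca_zero[OF assms] unfolding linear_gca_iff
  by (metis add.left_inverse eq_neg_iff_add_eq_0)

lemma linear_gca_diff:
  fixes f :: "'v::graded_generators free_gca \<Rightarrow> 'v free_gca"
  assumes "Vector_Spaces.linear (*\<^sub>Q) (*\<^sub>Q) f" shows "f (a - b) = f a - f b"
  using assms linear_gca_uminus[OF assms] unfolding linear_gca_iff
  by (metis uminus_add_conv_diff)

lemma linear_gca_sign:
  fixes f :: "'v::graded_generators free_gca \<Rightarrow> 'v free_gca"
  assumes "Vector_Spaces.linear (*\<^sub>Q) (*\<^sub>Q) f" shows "f ((-1) ^ k * a) = (-1) ^ k * f a"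
  using assms unfolding linear_gca_iff neg_one_power_mult by blast

lemma mcoeff_add: "mcoeff (a + b) m = mcoeff a m + mcoeff b m"
  by (simp add: plus_free_gca.rep_eq)

lemma mcoeff_uminus: "mcoeff (- a) m = - mcoeff a m"
  by (simp add: uminus_free_gca.rep_eq)

lemma mcoeff_zero: "mcoeff 0 m = 0"
  by (simp add: zero_free_gca.rep_eq)

lemma free_gca_eqI: "(\<And>m. mcoeff a m = mcoeff b m) \<Longrightarrow> a = b"
  by (simp add: mcoeff_inject[symmetric] fun_eq_iff)

lemma mdeg_union: "mdeg (a + b) = mdeg a + mdeg b"
  by (simp add: mdeg_def)

lemma grade_subspace: "gca.subspace (grade k)"
  by (rule gca.subspaceI) (auto simp: grade_def mcoeff_zero mcoeff_add qscale.rep_eq,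
      metis add.right_neutral)

lemma grade_zero: "0 \<in> grade k"
  by (rule gca.subspace_0[OF grade_subspace])

lemma grade_add: "a \<in> grade k \<Longrightarrow> b \<in> grade k \<Longrightarrow> a + b \<in> grade k"
  by (rule gca.subspace_add[OF grade_subspace])

lemma grade_uminus: "a \<in> grade k \<Longrightarrow> - a \<in> grade k"
  by (simp add: grade_def mcoeff_uminus)

lemma grade_diff: "a \<in> grade k \<Longrightarrow> b \<in> grade k \<Longrightarrow> a - b \<in> grade k"
  by (metis grade_add grade_uminus minus_free_gca_def)

lemma grade_sign: "a \<in> grade k \<Longrightarrow> (-1) ^ j * a \<in> grade k"
  unfolding neg_one_power_mult by (rule gca.subspace_scale[OF grade_subspace])

lemma grade_one: "1 \<in> grade 0"
  by (auto simp: grade_def one_free_gca.rep_eq mdeg_def split: if_splits)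

lemma grade_mult:
  assumes "a \<in> grade i" "b \<in> grade j"
  shows "a * b \<in> grade (i + j)"
proof -
  have "mdeg m = i + j" if nz: "mcoeff (a * b) m \<noteq> 0" for m
  proof -
    obtain c where c: "c \<subseteq># m" "mcoeff a c \<noteq> 0" "mcoeff b (m - c) \<noteq> 0"
      using sum.not_neutral_contains_not_neutral[OF nz[unfolded times_free_gca.rep_eq]] by auto
    then have "mdeg c = i" "mdeg (m - c) = j" using assms by (auto simp: grade_def)
    then show ?thesis using c(1) by (metis mdeg_union subset_mset.add_diff_inverse)
  qed
  then show ?thesis by (simp add: grade_def)
qed

lemma grade_power: "a \<in> grade i \<Longrightarrow> a ^ k \<in> grade (k * i)"
  by (induction k) (auto simp: grade_one intro: grade_mult)

lemma grade_unique: "a \<in> grade i \<Longrightarrow> a \<in> grade j \<Longrightarrow> a \<noteq> 0 \<Longrightarrow> i = j"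
  unfolding grade_def by (metis (mono_tags, lifting) free_gca_eqI mcoeff_zero mem_Collect_eq)

lemma grade_even_commute:
  assumes "a \<in> grade p" "b \<in> grade q" "even p"
  shows "a * b = b * a"
  using graded_commutative[OF assms(1,2)] assms(3) by simp

lemma square_odd_zero:
  assumes "a \<in> grade p" "odd p"
  shows "a * a = 0"
proof -
  have "a * a = - (a * a)" using graded_commutative[OF assms(1,1)] assms(2) by simp
  then have "mcoeff (a * a) m = 0" for m by (metis mcoeff_uminus equal_neg_zero)
  then show ?thesis by (intro free_gca_eqI) (simp add: mcoeff_zero)
qed

lemma of_nat_mult_qscale: "of_nat k * a = of_nat k *\<^sub>Q a"
  by (induction k) (simp_all add: gca.scale_left_distrib distrib_right)

lemma of_nat_mult_eq_zero: "of_nat k * a = 0 \<Longrightarrow> 0 < k \<Longrightarrow> a = 0"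
  for a :: "'v::graded_generators free_gca"
  unfolding of_nat_mult_qscale by simp

lemma gen_grade: "gen v \<in> grade (gdeg v)"
  by (auto simp: grade_def gen.rep_eq mdeg_def split: if_splits)

lemma V_deg_grade: "V_deg k \<subseteq> grade k"
  unfolding V_deg_def by (rule gca.span_minimal[OF _ grade_subspace]) (auto intro: gen_grade)

text \<open>Homogeneous elements of positive degree have no constant term, so a product of two of
  them involves only monomials with at least two factors; this passes to the span.\<close>

lemma decomposables_mcoeff:
  assumes "a \<in> decomposables"
  shows "mcoeff a {#v#} = 0" "mcoeff a {#} = 0"
proof -
  let ?S = "{a. mcoeff a {#v#} = 0 \<and> mcoeff a {#} = 0}"
  have sub: "{a. a \<subseteq># {#v#}} = {{#}, {#v#}}"
    by (auto simp: mset_subset_eq_exists_conv single_is_union)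
  have "decomposables \<subseteq> ?S"
    unfolding decomposables_def
  proof (rule gca.span_minimal)
    show "gca.subspace ?S"
      by (rule gca.subspaceI) (auto simp: mcoeff_zero mcoeff_add qscale.rep_eq)
    show "{a * b |a b i j. a \<in> grade i \<and> b \<in> grade j \<and> 0 < i \<and> 0 < j} \<subseteq> ?S"
    proof safe
      fix a b :: "'a free_gca" and i j :: nat
      assume "a \<in> grade i" "b \<in> grade j" "0 < i" "0 < j"
      then have "mcoeff a {#} = 0" "mcoeff b {#} = 0"
        by (auto simp: grade_def mdeg_def)
      then show "mcoeff (a * b) {#v#} = 0" "mcoeff (a * b) {#} = 0"
        by (auto simp: times_free_gca.rep_eq sub)
    qed
  qed
  with assms show "mcoeff a {#v#} = 0" "mcoeff a {#} = 0" by auto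
qed

section \<open>Partial derivatives with respect to generators\<close>

text \<open>The left derivative by \<open>v\<close>: the sign accounts for moving \<open>v\<close>
  to the front of the normal form, and \<open>count m v + 1\<close> is the exponent of
  \<open>v\<close> in \<open>add_mset v m\<close>. For odd \<open>v\<close> already contained in
  \<open>m\<close> the sign is zero.\<close>

lift_definition pd :: "'v \<Rightarrow> 'v::graded_generators free_gca \<Rightarrow> 'v free_gca"
  is "\<lambda>v f m. of_nat (count m v + 1) * koszul_sign {#v#} m * f (add_mset v m)"
proof -
  fix v :: 'v and f :: "'v multiset \<Rightarrow> rat"
  assume f: "finite {m. f m \<noteq> 0} \<and> (\<forall>m. f m \<noteq> 0 \<longrightarrow> admissible m)"
  let ?h = "\<lambda>m. of_nat (count m v + 1) * koszul_sign {#v#} m * f (add_mset v m)"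
  have "{m. ?h m \<noteq> 0} \<subseteq> (\<lambda>m. m - {#v#}) ` {m. f m \<noteq> 0}"
    by (auto intro!: image_eqI[where x = "add_mset v _"])
  then have "finite {m. ?h m \<noteq> 0}" using f by (meson finite_imageI finite_subset)
  moreover have "admissible m" if "?h m \<noteq> 0" for m
    using that f unfolding admissible_def
    by (metis add_leD1 add_mset_add_single count_union mult_zero_right)
  ultimately show "finite {m. ?h m \<noteq> 0} \<and> (\<forall>m. ?h m \<noteq> 0 \<longrightarrow> admissible m)" by blast
qed

lemma pd_linear: "Vector_Spaces.linear (*\<^sub>Q) (*\<^sub>Q) (pd v)"
  unfolding linear_gca_iff by (auto intro!: free_gca_eqI simp: pd.rep_eq mcoeff_add qscale.rep_eq algebra_simps)

lemma koszul_sign_square: "admissible (a + b) \<Longrightarrow> koszul_sign a b * koszul_sign a b = 1"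
  by (simp add: koszul_sign_def flip: power_add)

lemma admissible_mono: "admissible b \<Longrightarrow> a \<subseteq># b \<Longrightarrow> admissible a"
  unfolding admissible_def by (meson mset_subset_eq_count order_trans)

lemma mcoeff_admissible: "mcoeff a m \<noteq> 0 \<Longrightarrow> admissible m"
  using mcoeff[of a] by auto

text \<open>Coefficients at \<open>m\<close> are compared. A splitting of
  \<open>add_mset v m\<close> distributes the copies of \<open>v\<close> over the two factors;
  removing a copy on the left or on the right gives the two Leibniz terms, with signs matched by
  \<open>koszul_sign_cocycle\<close> and \<open>koszul_sign_swap\<close>.\<close>

lemma pd_leibniz:
  assumes a: "a \<in> grade k"
  shows "pd v (a * b) = pd v a * b + (-1) ^ (gdeg v * k) * (a * pd v b)"
proof (rule free_gca_eqI)
  fix m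
  let ?f = "mcoeff a" and ?g = "mcoeff b" and ?m = "add_mset v m"
  let ?c = "\<lambda>x. rat_of_nat (count x v)"
  let ?K = "koszul_sign {#v#} m"
  let ?s = "(-1::rat) ^ (gdeg v * k)"
  let ?T = "\<lambda>x y. koszul_sign x y * ?f x * ?g y"
  let ?A = "\<lambda>x. koszul_sign x (m - x) *
    (rat_of_nat (count x v + 1) * koszul_sign {#v#} x * ?f (add_mset v x)) * ?g (m - x)"
  let ?B = "\<lambda>x. ?s * (koszul_sign x (m - x) * ?f x *
    (rat_of_nat (count (m - x) v + 1) * koszul_sign {#v#} (m - x) * ?g (add_mset v (m - x))))"
  have lhs: "mcoeff (pd v (a * b)) m = ?c ?m * ?K * (\<Sum>x | x \<subseteq># ?m. ?T x (?m - x))"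
    by (simp add: pd.rep_eq times_free_gca.rep_eq)
  have rhs: "mcoeff (pd v a * b + (-1) ^ (gdeg v * k) * (a * pd v b)) m =
      (\<Sum>x | x \<subseteq># m. ?A x) + (\<Sum>x | x \<subseteq># m. ?B x)"
    by (simp add: mcoeff_add neg_one_power_mult qscale.rep_eq times_free_gca.rep_eq pd.rep_eq sum_distrib_left)
  have deg: "?f x \<noteq> 0 \<Longrightarrow> mdeg x = k" for x using a by (auto simp: grade_def)
  have coc: "koszul_sign {#v#} (x + y) * koszul_sign x y = koszul_sign (add_mset v x) y * koszul_sign {#v#} x"
     "koszul_sign x (add_mset v y) * koszul_sign {#v#} y = koszul_sign (add_mset v x) y * koszul_sign x {#v#}"
     "koszul_sign x {#v#} = (-1) ^ (gdeg v * mdeg x) * koszul_sign {#v#} x" for x y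
    using koszul_sign_cocycle[of "{#v#}" x y] koszul_sign_cocycle[of x "{#v#}" y] koszul_sign_swap[of x "{#v#}"]
    by (simp_all add: mdeg_def mult.commute)
  \<comment> \<open>Rearrangements of the identities \<open>coc\<close>: the signs to be moved
    square to one, hence may be carried to the other side.\<close>
  have alg1: "K * t = s * b" if "K * K = 1" "b * b = 1" "K * s = t * b" for K s t b :: rat
  proof -
    have "K * t = K * (t * b) * b" by (simp add: mult.assoc that(2))
    also have "\<dots> = K * K * (s * b)" by (simp only: that(3)[symmetric] mult.assoc)
    finally show ?thesis by (simp add: that(1))
  qed
  have alg2: "K * w = e * s * y"
    if "K * K = 1" "b * b = 1" "y * y = 1" "K * s = t * b" "w * y = t * (e * b)" for K s t b w y e :: rat
  proof -
    have "K * w = K * (w * y) * y" by (simp add: mult.assoc that(3))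
    also have "\<dots> = e * (K * (t * b)) * y" by (simp add: that(5) ac_simps)
    also have "\<dots> = e * (K * K * s) * y" by (simp only: that(4)[symmetric] mult.assoc)
    finally show ?thesis by (simp add: that(1))
  qed
  have alg3: "w * b = e * t * y"
    if "b * b = 1" "y * y = 1" "w * y = t * (e * b)" for t b w y e :: rat
  proof -
    have "w * b = (w * y) * y * b" by (simp add: mult.assoc that(2))
    also have "\<dots> = e * t * y * (b * b)" by (simp add: that(3) ac_simps)
    finally show ?thesis by (simp add: that(1))
  qed
  consider (adm) "admissible ?m" | (nadm) "\<not> admissible m" | (rep) "\<not> admissible ?m" "admissible m" by blast
  then show "mcoeff (pd v (a * b)) m = mcoeff (pd v a * b + (-1) ^ (gdeg v * k) * (a * pd v b)) m"
  proof cases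
    case nadm
    then show ?thesis using mcoeff_admissible by metis
  next
    case adm
    have sq: "koszul_sign x y * koszul_sign x y = 1" if "x + y \<subseteq># ?m" for x y
      using koszul_sign_square admissible_mono[OF adm that] by blast
    have split: "?c ?m = ?c x + ?c (?m - x)" if "x \<subseteq># ?m" for x
      using that by (metis count_union of_nat_add subset_mset.add_diff_inverse)
    have "?c ?m * ?K * (\<Sum>x | x \<subseteq># ?m. ?T x (?m - x)) =
      (\<Sum>x | x \<subseteq># ?m. ?K * ?c x * ?T x (?m - x)) +
      (\<Sum>x | x \<subseteq># ?m. ?K * ?c (?m - x) * ?T x (?m - x))"
      unfolding sum_distrib_left sum.distrib[symmetric]
      by (rule sum.cong[OF refl]) (simp only: split mem_Collect_eq, simp add: algebra_simps)
    also have "(\<Sum>x | x \<subseteq># ?m. ?K * ?c x * ?T x (?m - x)) =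
      (\<Sum>x \<in> add_mset v ` {x. x \<subseteq># m}. ?K * ?c x * ?T x (?m - x))"
    proof (rule sum.mono_neutral_right)
      show "\<forall>x\<in>{x. x \<subseteq># ?m} - add_mset v ` {x. x \<subseteq># m}. ?K * ?c x * ?T x (?m - x) = 0"
      proof
        fix x assume x: "x \<in> {x. x \<subseteq># ?m} - add_mset v ` {x. x \<subseteq># m}"
        have "v \<notin># x"
        proof
          assume "v \<in># x"
          then obtain y where "x = add_mset v y" by (meson mset_add)
          with x show False by auto
        qed
        then show "?K * ?c x * ?T x (?m - x) = 0" by (simp add: not_in_iff)
      qed
    qed (auto simp: finite_submultisets)
    also have "\<dots> = (\<Sum>x | x \<subseteq># m. ?K * ?c (add_mset v x) * ?T (add_mset v x) (m - x))"
      by (subst sum.reindex) (auto simp: inj_on_def)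
    also have "\<dots> = (\<Sum>x | x \<subseteq># m. ?A x)"
    proof (rule sum.cong[OF refl])
      fix x assume "x \<in> {x. x \<subseteq># m}"
      then obtain y where m: "m = x + y" by (auto simp: mset_subset_eq_exists_conv)
      have "?K * ?K = 1" "koszul_sign {#v#} x * koszul_sign {#v#} x = 1"
        by (rule sq; simp add: m)+
      then have "?K * koszul_sign (add_mset v x) y = koszul_sign x y * koszul_sign {#v#} x"
        using coc(1)[of x y, folded m] by (rule alg1)
      then show "?K * ?c (add_mset v x) * ?T (add_mset v x) (m - x) = ?A x"
        by (simp add: m algebra_simps)
    qed
    also have "(\<Sum>x | x \<subseteq># ?m. ?K * ?c (?m - x) * ?T x (?m - x)) =
      (\<Sum>x | x \<subseteq># m. ?K * ?c (?m - x) * ?T x (?m - x))"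
    proof (rule sum.mono_neutral_right)
      show "\<forall>x\<in>{x. x \<subseteq># ?m} - {x. x \<subseteq># m}. ?K * ?c (?m - x) * ?T x (?m - x) = 0"
      proof
        fix x assume x: "x \<in> {x. x \<subseteq># ?m} - {x. x \<subseteq># m}"
        then obtain y where y: "?m = x + y" by (auto simp: mset_subset_eq_exists_conv)
        have "v \<notin># y"
        proof
          assume "v \<in># y"
          then obtain z where "y = add_mset v z" by (meson mset_add)
          with x y show False by simp
        qed
        then show "?K * ?c (?m - x) * ?T x (?m - x) = 0" by (simp add: not_in_iff y)
      qed
    qed (auto simp: finite_submultisets intro: subset_mset.order_trans)
    also have "\<dots> = (\<Sum>x | x \<subseteq># m. ?B x)"
    proof (rule sum.cong[OF refl])
      fix x assume "x \<in> {x. x \<subseteq># m}"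
      then obtain y where m: "m = x + y" by (auto simp: mset_subset_eq_exists_conv)
      have "?K * ?K = 1" "koszul_sign {#v#} x * koszul_sign {#v#} x = 1"
        "koszul_sign {#v#} y * koszul_sign {#v#} y = 1"
        by (rule sq; simp add: m)+
      then have "?K * koszul_sign x (add_mset v y) =
          (-1) ^ (gdeg v * mdeg x) * koszul_sign x y * koszul_sign {#v#} y"
        using coc(1)[of x y, folded m] coc(2)[of x y, unfolded coc(3)[of x]] by (rule alg2)
      then show "?K * ?c (?m - x) * ?T x (?m - x) = ?B x"
        using deg[of x] by (cases "?f x = 0") (simp_all add: m algebra_simps)
    qed
    finally show ?thesis unfolding lhs rhs .
  next
    \<comment> \<open>Here \<open>v\<close> is odd and occurs in \<open>m\<close>, so the left side
      vanishes. On the right, the \<open>?B\<close> term at \<open>add_mset v x\<close> cancels the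
      \<open>?A\<close> term at \<open>x\<close> whenever \<open>v\<close> is not in
      \<open>x\<close>; all other terms contain a zero sign.\<close>
    case rep
    have od: "odd (gdeg v)" and v: "v \<in># m"
      using rep unfolding admissible_def by (auto split: if_splits simp: not_in_iff)
    have cm: "count m v = 1" using rep(2) od v unfolding admissible_def
      by (metis count_greater_eq_one_iff le_antisym)
    have K: "?K = 0" using rep(1) by (simp add: koszul_sign_def)
    have sq: "koszul_sign x y * koszul_sign x y = 1" if "x + y \<subseteq># m" for x y
      using koszul_sign_square admissible_mono[OF rep(2) that] by blast
    let ?X = "{x. x \<subseteq># m \<and> v \<notin># x}"
    have zero: "koszul_sign {#v#} y = 0" if "v \<in># y" for y
      using that od unfolding koszul_sign_def admissible_def by auto
    have "(\<Sum>x | x \<subseteq># m. ?B x) = (\<Sum>x \<in> add_mset v ` ?X. ?B x)"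
    proof (rule sum.mono_neutral_right)
      show "add_mset v ` ?X \<subseteq> {x. x \<subseteq># m}"
      proof safe
        fix x assume "x \<subseteq># m" "v \<notin># x"
        then show "add_mset v x \<subseteq># m"
          using v by (auto simp: subseteq_mset_def not_in_iff Suc_le_eq)
      qed
      show "\<forall>x\<in>{x. x \<subseteq># m} - add_mset v ` ?X. ?B x = 0"
      proof
        fix x assume x: "x \<in> {x. x \<subseteq># m} - add_mset v ` ?X"
        have "v \<notin># x"
        proof
          assume "v \<in># x"
          then obtain y where y: "x = add_mset v y" by (meson mset_add)
          with x have "x \<subseteq># m" by simp
          then have "count x v \<le> 1" using cm by (metis mset_subset_eq_count)
          then have "y \<in> ?X" using y \<open>x \<subseteq># m\<close>
            by (auto simp: not_in_iff dest!: mset_subset_eq_insertD intro: subset_mset.less_imp_le)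
          with x y show False by auto
        qed
        then have "v \<in># m - x" using v by (simp add: in_diff_count not_in_iff)
        then show "?B x = 0" by (simp add: zero)
      qed
    qed (auto simp: finite_submultisets)
    also have "\<dots> = (\<Sum>x\<in>?X. ?B (add_mset v x))"
      by (subst sum.reindex) (auto simp: inj_on_def)
    also have "\<dots> = (\<Sum>x\<in>?X. - ?A x)"
    proof (rule sum.cong[OF refl])
      fix x assume x: "x \<in> ?X"
      then obtain z where z: "m = x + z" by (auto simp: mset_subset_eq_exists_conv)
      with x v have "v \<in># z" by auto
      then obtain y where y: "z = add_mset v y" by (meson mset_add)
      note m = z[unfolded y]
      have c0: "count x v = 0" "count y v = 0" using cm m by auto
      have "koszul_sign {#v#} x * koszul_sign {#v#} x = 1"
        "koszul_sign {#v#} y * koszul_sign {#v#} y = 1"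
        by (rule sq; simp add: m)+
      then have e: "koszul_sign x (add_mset v y) * koszul_sign {#v#} x =
          (-1) ^ (gdeg v * mdeg x) * koszul_sign (add_mset v x) y * koszul_sign {#v#} y"
        using coc(2)[of x y, unfolded coc(3)[of x]] by (rule alg3)
      have s: "(-1::rat) ^ (gdeg v * mdeg x) = - ?s" if "?f (add_mset v x) \<noteq> 0"
        using deg[OF that] od by (auto simp: mdeg_def distrib_left power_add)
      show "?B (add_mset v x) = - ?A x"
        using e s by (cases "?f (add_mset v x) = 0") (simp_all add: m c0 algebra_simps)
    qed
    also have "\<dots> = - (\<Sum>x | x \<subseteq># m. ?A x)"
      unfolding sum_negf
      by (rule arg_cong[of _ _ uminus], rule sum.mono_neutral_left) (auto simp: finite_submultisets zero)
    finally show ?thesis unfolding lhs rhs K by simp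
  qed
qed

lemma pd_derivation: "derivation (gdeg v) (pd v)"
  unfolding derivation_def
proof (intro conjI allI ballI impI pd_linear pd_leibniz)
  have deg: "mdeg m + gdeg v = k" if "a \<in> grade k" "mcoeff (pd v a) m \<noteq> 0" for k a m
    using that by (auto simp: grade_def pd.rep_eq mdeg_def)
  show "pd v a \<in> grade k" if "a \<in> grade (k + gdeg v)" for k a
    using deg[OF that] by (simp add: grade_def)
  show "pd v a = 0" if "k < gdeg v" "a \<in> grade k" for k a
    using deg[OF that(2)] that(1) by (intro free_gca_eqI) (force simp: mcoeff_zero)
qed

lemma pd_gen: "pd v (gen w) = (if v = w then 1 else 0)"
  by (rule free_gca_eqI)
    (auto simp: pd.rep_eq gen.rep_eq mcoeff_zero one_free_gca.rep_eq koszul_sign_def inversions_def admissible_def)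

text \<open>\<open>pd v\<close> reads off coefficients of monomials containing \<open>v\<close>. The
  monomial \<open>v\<close> alone does not occur in a decomposable element, and any further factor
  raises the degree to at least \<open>gdeg v + 2\<close>.\<close>

lemma pd_decomposable_zero:
  fixes v :: "'v::graded_generators"
  assumes "a \<in> decomposables" "a \<in> grade k" "k \<le> gdeg v + 1" "\<And>w::'v. 2 \<le> gdeg w"
  shows "pd v a = 0"
proof (rule free_gca_eqI)
  fix m
  have "mcoeff a (add_mset v m) = 0"
  proof (cases m)
    case empty
    then show ?thesis by (simp add: decomposables_mcoeff[OF assms(1)])
  next
    case (add w m')
    then have "mdeg (add_mset v m) \<ge> gdeg v + 2" using assms(4)[of w] by (simp add: mdeg_def)
    then show ?thesis using assms(2,3) by (auto simp: grade_def)
  qed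
  then show "mcoeff (pd v a) m = mcoeff 0 m" by (simp add: pd.rep_eq mcoeff_zero)
qed

section \<open>Derivations\<close>

lemma derivation_linear: "derivation n D \<Longrightarrow> Vector_Spaces.linear (*\<^sub>Q) (*\<^sub>Q) D"
  and derivation_grade: "derivation n D \<Longrightarrow> a \<in> grade (k + n) \<Longrightarrow> D a \<in> grade k"
  and derivation_low: "derivation n D \<Longrightarrow> a \<in> grade k \<Longrightarrow> k < n \<Longrightarrow> D a = 0"
  and derivation_mult: "derivation n D \<Longrightarrow> a \<in> grade k \<Longrightarrow> D (a * b) = D a * b + (-1) ^ (n * k) * (a * D b)"
  unfolding derivation_def by blast+

lemma derivation_add: "derivation n D \<Longrightarrow> D (a + b) = D a + D b"
  using derivation_linear linear_gca_iff by blast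

lemma derivation_zero: "derivation n D \<Longrightarrow> D 0 = 0"
  using derivation_linear linear_gca_zero by blast

text \<open>The truncated subtraction is harmless: for \<open>k < n\<close> the value is zero, which
  lies in every grade.\<close>

lemma derivation_grade_diff: "derivation n D \<Longrightarrow> a \<in> grade k \<Longrightarrow> D a \<in> grade (k - n)"
  by (metis derivation_grade derivation_low grade_zero le_add_diff_inverse2 not_le)

lemma derivation_one: assumes "derivation n D" shows "D 1 = 0"
  using derivation_mult[OF assms grade_one, of 1] by simp

lemma derivation_scaled_sum:
  assumes "finite S" "\<And>v. v \<in> S \<Longrightarrow> derivation n (D v)"
  shows "derivation n (\<lambda>a. \<Sum>v\<in>S. c v *\<^sub>Q D v a)"
  unfolding derivation_def linear_gca_iff
proof (intro conjI allI ballI impI)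
  fix a b :: "'b free_gca" and q k
  note lin = assms(2)[THEN derivation_linear, unfolded linear_gca_iff]
  show "(\<Sum>v\<in>S. c v *\<^sub>Q D v (a + b)) = (\<Sum>v\<in>S. c v *\<^sub>Q D v a) + (\<Sum>v\<in>S. c v *\<^sub>Q D v b)"
    using lin by (simp add: gca.scale_right_distrib flip: sum.distrib)
  show "(\<Sum>v\<in>S. c v *\<^sub>Q D v (q *\<^sub>Q a)) = q *\<^sub>Q (\<Sum>v\<in>S. c v *\<^sub>Q D v a)"
    using lin by (simp add: gca.scale_sum_right mult.commute)
  show "(\<Sum>v\<in>S. c v *\<^sub>Q D v a) \<in> grade k" if "a \<in> grade (k + n)"
    using derivation_grade[OF assms(2) that]
    by (intro gca.subspace_sum[OF grade_subspace] gca.subspace_scale[OF grade_subspace]) auto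
  show "(\<Sum>v\<in>S. c v *\<^sub>Q D v a) = 0" if "k < n" "a \<in> grade k"
    using derivation_low[OF assms(2) that(2,1)] by simp
  show "(\<Sum>v\<in>S. c v *\<^sub>Q D v (a * b)) =
    (\<Sum>v\<in>S. c v *\<^sub>Q D v a) * b + (-1) ^ (n * k) * (a * (\<Sum>v\<in>S. c v *\<^sub>Q D v b))" if "a \<in> grade k"
    using derivation_mult[OF assms(2) that, of _ b]
    by (simp add: gca.scale_right_distrib sum.distrib sum_distrib_left sum_distrib_right
        qscale_mult_left qscale_mult_right)
qed

text \<open>Provides the partial derivative by \<open>u i\<close> for a homogeneous basis that need
  not consist of the generators. The last property is meant for differentials of basis elements of
  degree at most \<open>e i\<close>.\<close>

lemma dual_derivation:
  fixes u :: "nat \<Rightarrow> 'v::graded_generators free_gca"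
  assumes basis: "ordered_homogeneous_basis I e u" and i: "i \<in> I"
    and fin: "finite {v::'v. gdeg v = e i}" and ge2: "\<And>w::'v. 2 \<le> gdeg w"
  obtains D where "derivation (e i) D"
    and "\<And>j. j \<in> I \<Longrightarrow> D (u j) = (if j = i then 1 else 0)"
    and "\<And>a k. a \<in> decomposables \<Longrightarrow> a \<in> grade k \<Longrightarrow> k \<le> e i + 1 \<Longrightarrow> D a = 0"
proof -
  let ?B = "u ` I" and ?S = "{v::'v. gdeg v = e i}"
  have inj: "inj_on u I" and ind: "gca.independent ?B" and span: "gca.span ?B = V_all"
    and deg: "\<And>j. j \<in> I \<Longrightarrow> u j \<in> V_deg (e j)"
    using basis by (auto simp: ordered_homogeneous_basis_def)
  let ?r = "\<lambda>y. gca.representation ?B y (u i)"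
  \<comment> \<open>The weight of \<open>pd v\<close> is the \<open>u i\<close>-coordinate of
    \<open>gen v\<close>, so \<open>D\<close> agrees with this coordinate on
    \<open>V_deg (e i)\<close>; in other degrees it vanishes on \<open>V\<close> because only
    generators of degree \<open>e i\<close> enter.\<close>
  define D where "D = (\<lambda>a. \<Sum>v\<in>?S. ?r (gen v) *\<^sub>Q pd v a)"
  have der: "derivation (e i) D"
    unfolding D_def by (rule derivation_scaled_sum[OF fin]) (metis mem_Collect_eq pd_derivation)
  have same: "D y = ?r y *\<^sub>Q 1" if "y \<in> V_deg (e i)" for y
  proof -
    have "V_deg (e i) \<subseteq> {y. y \<in> gca.span ?B \<and> D y = ?r y *\<^sub>Q 1}"
      unfolding V_deg_def
    proof (rule gca.span_minimal)
      show "gen ` {v. gdeg v = e i} \<subseteq> {y. y \<in> gca.span ?B \<and> D y = ?r y *\<^sub>Q 1}"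
        by (auto simp: span V_all_def D_def pd_gen fin if_distrib[of "(*\<^sub>Q) _"] gca.span_base cong: if_cong)
      show "gca.subspace {y. y \<in> gca.span ?B \<and> D y = ?r y *\<^sub>Q 1}"
        using derivation_linear[OF der, unfolded linear_gca_iff] derivation_zero[OF der]
        by (intro gca.subspaceI)
          (auto simp: gca.span_zero gca.span_add gca.span_scale gca.representation_zero
             gca.representation_add[OF ind] gca.representation_scale[OF ind] gca.scale_left_distrib)
    qed
    with that show ?thesis by auto
  qed
  have other: "D y = 0" if "y \<in> V_deg k" "k \<noteq> e i" for y k
  proof -
    have "V_deg k \<subseteq> {y. D y = 0}"
      unfolding V_deg_def
    proof (rule gca.span_minimal)
      show "gen ` {v. gdeg v = k} \<subseteq> {y. D y = 0}"
        using that(2) by (auto simp: D_def pd_gen intro!: sum.neutral)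
      show "gca.subspace {y. D y = 0}"
        using derivation_linear[OF der, unfolded linear_gca_iff] derivation_zero[OF der]
        by (intro gca.subspaceI) auto
    qed
    with that(1) show ?thesis by auto
  qed
  show ?thesis
  proof (rule that[OF der])
    fix j assume j: "j \<in> I"
    have "?r (u j) = (if j = i then 1 else 0)"
      using i j inj by (simp add: gca.representation_basis[OF ind] inj_on_eq_iff)
    then show "D (u j) = (if j = i then 1 else 0)"
      using same[of "u j"] other[of "u j" "e j"] deg[OF j] by (cases "e j = e i") auto
  next
    fix a :: "'v free_gca" and k assume "a \<in> decomposables" "a \<in> grade k" "k \<le> e i + 1"
    then have "pd v a = 0" if "v \<in> ?S" for v
      using pd_decomposable_zero[OF _ _ _ ge2, of a k v] that by auto
    then show "D a = 0" by (simp add: D_def)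
  qed
qed

section \<open>Polynomials in an even element\<close>

lemma derivation_power:
  assumes D: "derivation n D" and u: "u \<in> grade e" "even e" and Du: "D u = 1" "even n"
  shows "D (u ^ m) = of_nat m * u ^ (m - 1)"
proof (induction m)
  case 0
  then show ?case by (simp add: derivation_one[OF D])
next
  case (Suc m)
  have "D (u ^ Suc m) = u ^ m + u * (of_nat m * u ^ (m - 1))"
    using derivation_mult[OF D u(1), of "u ^ m"] Suc u(2) Du by simp
  also have "u * (of_nat m * u ^ (m - 1)) = of_nat m * (u * u ^ (m - 1))"
    by (simp add: of_nat_mult_qscale qscale_mult_right)
  also have "\<dots> = of_nat m * u ^ m" by (cases m) simp_all
  finally show ?case by (simp add: algebra_simps)
qed

text \<open>Outer induction on the degree of \<open>a\<close> gives \<open>D a = 0\<close>; then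
  \<open>D\<close> turns \<open>u ^ Suc j * a = 0\<close> into \<open>u ^ j * a = 0\<close> up to a
  positive integer. Arbitrary powers are allowed since the outer induction raises the
  exponent.\<close>

lemma even_nonzero_divisor:
  assumes D: "derivation e D" and u: "u \<in> grade e" and Du: "D u = 1" and e: "even e" "0 < e"
    and a: "a \<in> grade k" "u ^ j * a = 0"
  shows "a = 0"
  using a
proof (induction k arbitrary: a j rule: less_induct)
  case (less k)
  have Da: "D a = 0" if ua: "u ^ j * a = 0" for j
  proof (cases "k < e")
    case True
    then show ?thesis using derivation_low[OF D less.prems(1)] by blast
  next
    case False
    have "0 = D (u ^ j * a)" using ua derivation_zero[OF D] by simp
    also have "\<dots> = of_nat j * u ^ (j - 1) * a + u ^ j * D a"
      using derivation_mult[OF D grade_power[OF u]] derivation_power[OF D u e(1) Du e(1)] e(1) by simp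
    \<comment> \<open>Multiplication by \<open>u\<close> restores the power in the first summand,
      which then vanishes by assumption. What remains concerns \<open>D a\<close>, of smaller
      degree.\<close>
    finally have "0 = u * (of_nat j * u ^ (j - 1) * a + u ^ j * D a)" by simp
    also have "\<dots> = of_nat j * (u * u ^ (j - 1) * a) + u ^ Suc j * D a"
      by (simp add: distrib_left of_nat_mult_qscale qscale_mult_right qscale_mult_left mult.assoc)
    also have "of_nat j * (u * u ^ (j - 1) * a) = 0"
      using ua by (cases j) simp_all
    finally have "u ^ Suc j * D a = 0" by simp
    moreover have "D a \<in> grade (k - e)" using derivation_grade_diff[OF D less.prems(1)] .
    ultimately show ?thesis using False e(2) by (intro less.IH[of "k - e" "D a" "Suc j"]) auto
  qed
  have "u ^ j * a = 0 \<Longrightarrow> a = 0" for j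
  proof (induction j)
    case (Suc j)
    have "0 = D (u ^ Suc j * a)" using Suc.prems derivation_zero[OF D] by simp
    also have "\<dots> = of_nat (Suc j) * (u ^ j * a) + u ^ Suc j * D a"
      using derivation_mult[OF D grade_power[OF u]] derivation_power[OF D u e(1) Du e(1)] e(1)
      by (simp add: mult.assoc del: power_Suc of_nat_Suc)
    also have "\<dots> = of_nat (Suc j) * (u ^ j * a)" by (simp add: Da[OF Suc.prems])
    finally show ?case using of_nat_mult_eq_zero Suc.IH by (metis zero_less_Suc)
  qed simp
  with less.prems(2) show ?case by blast
qed

text \<open>If \<open>D\<close> kills \<open>a\<close> and \<open>b\<close>, these are the coefficients of a polynomial in \<open>u\<close>.\<close>

lemma even_leading_coefficient_zero:
  assumes D: "derivation e D" and u: "u \<in> grade e" and Du: "D u = 1" and e: "even e"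
    and a: "D a = 0" and b: "D b = 0" and eq: "u ^ m * a + of_nat m * (u ^ (m - 1) * b) = 0"
  shows "a = 0"
  using eq
proof (induction m)
  case (Suc m)
  have der: "D (u ^ j * c) = of_nat j * (u ^ (j - 1) * c)" if "D c = 0" for j c
    using derivation_mult[OF D grade_power[OF u]] derivation_power[OF D u e Du e] e that
    by (simp add: mult.assoc)
  \<comment> \<open>Applying \<open>D\<close> yields \<open>Suc m\<close> times the same equation
    for \<open>m\<close>. At \<open>m = 0\<close> the equation reads \<open>a = 0\<close>.\<close>
  have "0 = D (u ^ Suc m * a + of_nat (Suc m) *\<^sub>Q (u ^ m * b))"
    using Suc.prems by (simp add: derivation_zero[OF D] of_nat_mult_qscale del: of_nat_Suc)
  also have "\<dots> = of_nat (Suc m) * (u ^ m * a) + of_nat (Suc m) *\<^sub>Q (of_nat m * (u ^ (m - 1) * b))"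
    using derivation_linear[OF D, unfolded linear_gca_iff] der[OF a, of "Suc m"] der[OF b, of m]
    by (simp del: of_nat_Suc power_Suc)
  also have "\<dots> = of_nat (Suc m) * (u ^ m * a + of_nat m * (u ^ (m - 1) * b))"
    by (simp add: of_nat_mult_qscale gca.scale_right_distrib del: of_nat_Suc)
  finally show ?case using of_nat_mult_eq_zero Suc.IH by (metis zero_less_Suc)
qed simp

section \<open>Cocycle monomials in a minimal algebra\<close>

locale minimal_algebra =
  fixes d :: "'v::graded_generators free_gca \<Rightarrow> 'v free_gca"
  assumes minimal: "minimal_sullivan_algebra d"
begin

lemma ge2: "2 \<le> gdeg (v::'v)"
  and finite_degree: "finite {v::'v. gdeg v = k}"
  and d_linear: "Vector_Spaces.linear (*\<^sub>Q) (*\<^sub>Q) d"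
  and d_grade: "a \<in> grade k \<Longrightarrow> d a \<in> grade (k + 1)"
  and d_mult: "a \<in> grade k \<Longrightarrow> d (a * b) = d a * b + (-1) ^ k * (a * d b)"
  and d_d: "d (d a) = 0"
  and d_decomposable: "d a \<in> decomposables"
  using minimal unfolding minimal_sullivan_algebra_def by blast+

lemma d_add: "d (a + b) = d a + d b"
  using d_linear linear_gca_iff by blast

lemmas d_zero = linear_gca_zero[OF d_linear]
  and d_diff = linear_gca_diff[OF d_linear]
  and d_sign = linear_gca_sign[OF d_linear]

lemma d_one: "d 1 = 0"
  using d_mult[OF grade_one, of 1] by simp

lemma d_power:
  assumes u: "u \<in> grade e" "even e"
  shows "d (u ^ m) = of_nat m * (u ^ (m - 1) * d u)"
proof (induction m)
  case (Suc m)
  have "d (u ^ Suc m) = u ^ m * d u + u * (of_nat m * (u ^ (m - 1) * d u))"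
    using d_mult[OF u(1), of "u ^ m"] Suc u(2)
      grade_even_commute[OF grade_power[OF u(1)] d_grade[OF u(1)], of m] by simp
  also have "u * (of_nat m * (u ^ (m - 1) * d u)) = of_nat m * (u * u ^ (m - 1) * d u)"
    by (simp add: of_nat_mult_qscale qscale_mult_right mult.assoc)
  also have "\<dots> = of_nat m * (u ^ m * d u)" by (cases m) simp_all
  finally show ?case by (simp add: algebra_simps)
qed (simp add: d_one)

text \<open>The common kernel of \<open>D\<close> and of \<open>D\<close> after \<open>d\<close> is
  closed under products, by the Leibniz rules. It will contain the factors preceding the last one of
  a monomial.\<close>

lemma kernel_mult:
  assumes D: "derivation n D" and a: "a \<in> grade k" "D a = 0" "D (d a) = 0"
    and b: "D b = 0" "D (d b) = 0"
  shows "D (a * b) = 0" "D (d (a * b)) = 0"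
proof -
  show "D (a * b) = 0" by (simp add: derivation_mult[OF D a(1)] a b)
  show "D (d (a * b)) = 0"
    by (simp add: d_mult[OF a(1)] derivation_add[OF D] linear_gca_sign[OF derivation_linear[OF D]]
        derivation_mult[OF D a(1)] derivation_mult[OF D d_grade[OF a(1)]] a b)
qed

lemma kernel_word:
  assumes D: "derivation n D"
    and u: "\<And>j. j \<in> set js \<Longrightarrow> u j \<in> grade (e j) \<and> D (u j) = 0 \<and> D (d (u j)) = 0"
  shows "D (prod_list (map (\<lambda>j. u j ^ m j) js)) = 0 \<and> D (d (prod_list (map (\<lambda>j. u j ^ m j) js))) = 0"
  using u
proof (induction js)
  case Nil
  then show ?case by (simp add: derivation_one[OF D] d_one derivation_zero[OF D])
next
  case (Cons j js)
  have uj: "u j \<in> grade (e j)" "D (u j) = 0" "D (d (u j)) = 0" using Cons.prems by auto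
  have pow: "D (u j ^ k) = 0 \<and> D (d (u j ^ k)) = 0" for k
  proof (induction k)
    case (Suc k)
    then show ?case using kernel_mult[OF D uj] by simp
  qed (simp add: derivation_one[OF D] d_one derivation_zero[OF D])
  show ?case
    using kernel_mult[OF D grade_power[OF uj(1)]] pow Cons by simp
qed

end

lemma word_grade:
  assumes "\<And>j. j \<in> set js \<Longrightarrow> u j \<in> grade (e j)"
  shows "prod_list (map (\<lambda>j. u j ^ m j) js) \<in> grade (\<Sum>j\<leftarrow>js. m j * e j)"
  using assms by (induction js) (auto intro: grade_one grade_mult grade_power)

context minimal_algebra
begin

lemma basis_degree_ge2:
  assumes basis: "ordered_homogeneous_basis I e (u :: nat \<Rightarrow> 'v free_gca)" and i: "i \<in> I"
  shows "2 \<le> e i"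
proof -
  have "u i \<noteq> 0" "u i \<in> V_deg (e i)"
    using basis i gca.dependent_zero[of "u ` I"] unfolding ordered_homogeneous_basis_def by auto
  then have "\<exists>v::'v. gdeg v = e i" unfolding V_deg_def
    by (metis (mono_tags, lifting) Collect_empty_eq gca.span_empty image_empty singletonD)
  then show ?thesis using ge2 by metis
qed

text \<open>
  Since \<open>d u\<^sub>j\<close> only involves generators of degree smaller than \<open>u\<^sub>j\<close>, the last factor can be
  differentiated away from \<open>d (w\<^sub>1 \<dots> w\<^sub>r) = 0\<close>, so every prefix of the monomial is a cocycle.
\<close>

lemma first_generator_cocycle:
  assumes basis: "ordered_homogeneous_basis I e (u :: nat \<Rightarrow> 'v free_gca)"
    and js: "js \<noteq> []" "set js \<subseteq> I" "sorted_wrt (<) js"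
      "\<forall>j\<in>set js. 1 \<le> m j \<and> (odd (e j) \<longrightarrow> m j = 1)"
    and closed: "d (prod_list (map (\<lambda>j. u j ^ m j) js)) = 0"
  shows "d (u (hd js)) = 0"
  using js closed
proof (induction js rule: rev_induct)
  case (snoc i js)
  have i: "i \<in> I" and le: "\<And>j. j \<in> set js \<Longrightarrow> j \<in> I \<and> j < i"
    using snoc.prems by (auto simp: sorted_wrt_append)
  have deg: "\<And>j. j \<in> I \<Longrightarrow> u j \<in> grade (e j)" and mono: "mono_on I e"
    using basis V_deg_grade unfolding ordered_homogeneous_basis_def by auto
  note ui = deg[OF i]
  have mi: "1 \<le> m i" "odd (e i) \<Longrightarrow> m i = 1" using snoc.prems(4) by auto
  obtain D where D: "derivation (e i) D"
    and Du: "\<And>j. j \<in> I \<Longrightarrow> D (u j) = (if j = i then 1 else 0)"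
    and Dd: "\<And>a k. a \<in> decomposables \<Longrightarrow> a \<in> grade k \<Longrightarrow> k \<le> e i + 1 \<Longrightarrow> D a = 0"
    using dual_derivation[OF basis i finite_degree ge2] by blast
  have Dui: "D (u i) = 1" using Du i by simp
  \<comment> \<open>\<open>d (u j)\<close> is decomposable of degree \<open>e j + 1\<close>. For the
    earlier factors the bound \<open>e j \<le> e i\<close> comes from
    \<open>mono_on I e\<close>.\<close>
  have Ddu: "D (d (u j)) = 0" if "j \<in> I" "e j \<le> e i" for j
    using Dd[OF d_decomposable d_grade[OF deg[OF that(1)]]] that(2) by simp
  show ?case
  proof (cases "js = []")
    case True
    then have du: "d (u i ^ m i) = 0" using snoc.prems(5) by simp
    show ?thesis
    proof (cases "even (e i)")
      case ev: True
      have "u i ^ (m i - 1) * d (u i) = 0"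
        using of_nat_mult_eq_zero[of "m i"] du mi(1) unfolding d_power[OF ui ev] by simp
      then show ?thesis
        using even_nonzero_divisor[OF D ui Dui ev _ d_grade[OF ui]] basis_degree_ge2[OF basis i] True by simp
    next
      case False
      then show ?thesis using du mi(2) True by simp
    qed
  next
    case False
    let ?A = "prod_list (map (\<lambda>j. u j ^ m j) js)"
    define a where "a = (\<Sum>j\<leftarrow>js. m j * e j)"
    have A: "?A \<in> grade a" unfolding a_def using le deg by (intro word_grade) auto
    have ker: "D ?A = 0" "D (d ?A) = 0"
      using kernel_word[OF D, of js u e m] le deg Du Ddu mono_onD[OF mono _ i] by force+
    let ?b = "(-1) ^ a * (?A * d (u i))"
    have b: "D ?b = 0"
      using linear_gca_sign[OF derivation_linear[OF D]] derivation_mult[OF D A] ker(1) Ddu[OF i] by simp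
    have eq: "d ?A * u i ^ m i + (-1) ^ a * (?A * d (u i ^ m i)) = 0"
      using snoc.prems(5) d_mult[OF A] by simp
    have "d ?A = 0"
    \<comment> \<open>For even \<open>u i\<close>, \<open>eq\<close> is a polynomial identity in
      \<open>u i\<close> with leading coefficient \<open>d ?A\<close> and coefficients killed by
      \<open>D\<close>. For odd \<open>u i\<close> the exponent is one, and applying
      \<open>D\<close> after moving \<open>u i\<close> to the front leaves \<open>d ?A\<close> up to
      sign.\<close>
    proof (cases "even (e i)")
      case ev: True
      have c1: "d ?A * u i ^ m i = u i ^ m i * d ?A"
        using grade_even_commute[OF grade_power[OF ui] d_grade[OF A], of "m i"] ev by simp
      have c2: "u i ^ (m i - 1) * ?A = ?A * u i ^ (m i - 1)"
        using grade_even_commute[OF grade_power[OF ui] A, of "m i - 1"] ev by simp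
      have "(-1) ^ a * (?A * d (u i ^ m i)) = of_nat (m i) * ((-1) ^ a * (?A * u i ^ (m i - 1) * d (u i)))"
        unfolding d_power[OF ui ev]
        by (simp add: of_nat_mult_qscale neg_one_power_mult qscale_mult_right qscale_mult_left mult.assoc mult.commute)
      also have "\<dots> = of_nat (m i) * (u i ^ (m i - 1) * ?b)"
        unfolding c2[symmetric] by (simp add: neg_one_power_mult qscale_mult_right mult.assoc)
      finally show ?thesis
        using even_leading_coefficient_zero[OF D ui Dui ev ker(2) b, of "m i"] eq c1 by simp
    next
      case od: False
      have "d ?A * u i = (-1) ^ ((a + 1) * e i) * (u i * d ?A)"
        using graded_commutative[OF d_grade[OF A] ui] .
      then have "0 = D ((-1) ^ ((a + 1) * e i) * (u i * d ?A) + ?b)"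
        using eq mi(2)[OF od] derivation_zero[OF D] by simp
      also have "\<dots> = (-1) ^ ((a + 1) * e i) * d ?A"
        using linear_gca_sign[OF derivation_linear[OF D]] derivation_add[OF D] derivation_mult[OF D ui]
          b Dui ker(2) by simp
      finally show ?thesis by (simp add: neg_one_power_mult)
    qed
    then have "d (u (hd js)) = 0"
      using snoc.IH snoc.prems False by (simp add: sorted_wrt_append)
    then show ?thesis using False by simp
  qed
qed simp

end

section \<open>Gottlieb elements with monomial differential\<close>

text \<open>For degree reasons \<theta> kills \<open>g\<close>, so both applications act on
  \<open>t\<close> alone, and \<open>t\<close> has degree below \<open>2 * n\<close>.\<close>

lemma derivation_twice_product_zero:
  assumes \<theta>: "derivation n \<theta>" and t: "t \<in> grade i" "i < 2 * n" and g: "g \<in> grade j" "j < n"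
  shows "\<theta> (\<theta> (t * g)) = 0"
proof -
  have 1: "\<theta> g = 0" using derivation_low[OF \<theta> g] .
  have \<theta>t: "\<theta> t \<in> grade (i - n)" using derivation_grade_diff[OF \<theta> t(1)] .
  have "\<theta> (\<theta> t) = 0"
  proof (cases "i < n")
    case True
    then show ?thesis using derivation_low[OF \<theta> t(1)] derivation_zero[OF \<theta>] by simp
  next
    case False
    then show ?thesis using derivation_low[OF \<theta> \<theta>t] t(2) by simp
  qed
  then show ?thesis using derivation_mult[OF \<theta> t(1), of g] derivation_mult[OF \<theta> \<theta>t, of g] 1 by simp
qed

context minimal_algebra
begin

text \<open>
  Solves \<open>d z = s u g\<close> with \<open>z\<close> a sum of products of elements of small degree, which \<open>\<theta> \<circ> \<theta>\<close> kills:
  with \<open>s u = d t\<close> and \<open>d g = u g'\<close>, the error term of \<open>t g\<close> is \<open>t u g'\<close>, and \<open>g'\<close> has smaller degree.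
  Minimality ensures that \<open>g'\<close> is never a nonzero scalar.
\<close>

lemma odd_cocycle_primitive:
  assumes u: "u \<in> grade e" "odd e" "2 \<le> e" "d u = 0"
    and D: "derivation e D" "D u = 1"
    and Dd: "\<And>a k. a \<in> decomposables \<Longrightarrow> a \<in> grade k \<Longrightarrow> k \<le> e + 1 \<Longrightarrow> D a = 0"
    and \<theta>: "derivation n \<theta>"
    and acyclic: "\<And>k a. n < k \<Longrightarrow> a \<in> grade k \<Longrightarrow> d a = 0 \<Longrightarrow> \<exists>y\<in>grade (k - 1). d y = a"
    and s: "s \<in> grade l" "d s * u = 0" and g: "g \<in> grade k" "u * d g = 0"
    and k: "0 < k" "k < n" "n \<le> l" "l + e + k = 2 * n + 1"
  shows "\<exists>z\<in>grade (2 * n). d z = s * u * g \<and> \<theta> (\<theta> z) = 0"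
  using s g k
proof (induction k arbitrary: s l g rule: less_induct)
  case (less k)
  note s = less.prems(1,2) and g = less.prems(3,4) and k = less.prems(5-8)
  have "d (s * u) = 0" by (simp add: d_mult[OF s(1)] s(2) u(4))
  then obtain t where t: "t \<in> grade (l + e - 1)" "d t = s * u"
    using acyclic[OF _ grade_mult[OF s(1) u(1)]] k u(3) by auto
  have tg: "t * g \<in> grade (2 * n)" using grade_mult[OF t(1) g(1)] k u(3) by (simp add: algebra_simps)
  have d_tg: "d (t * g) = s * u * g + (-1) ^ (l + e - 1) * (t * d g)"
    using d_mult[OF t(1), of g] t(2) by simp
  have \<theta>_tg: "\<theta> (\<theta> (t * g)) = 0"
    by (rule derivation_twice_product_zero[OF \<theta> t(1) _ g(1) k(2)]) (use k in simp)
  \<comment> \<open>Applying \<open>D\<close> to \<open>u * d g = 0\<close>, with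
    \<open>D u = 1\<close> and \<open>u\<close> odd, gives \<open>d g = u * D (d g)\<close>.\<close>
  define g' where "g' = D (d g)"
  have dg: "d g = u * g'"
    using derivation_mult[OF D(1) u(1), of "d g"] g(2) derivation_zero[OF D(1)] D(2) u(2)
    by (simp add: g'_def)
  show ?case
  \<comment> \<open>If \<open>k \<le> e\<close>, then \<open>d g\<close> is decomposable of degree
    at most \<open>e + 1\<close>, so \<open>g'\<close> vanishes and \<open>t * g\<close> is the
    solution. Otherwise \<open>g'\<close> has degree \<open>k + 1 - e\<close>, which is positive and
    below \<open>k\<close>.\<close>
  proof (cases "k \<le> e")
    case True
    then have "g' = 0" unfolding g'_def using Dd[OF d_decomposable d_grade[OF g(1)]] by simp
    then show ?thesis using tg d_tg \<theta>_tg dg by (intro bexI[of _ "t * g"]) auto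
  next
    case False
    have g': "g' \<in> grade (k + 1 - e)"
      unfolding g'_def by (rule derivation_grade_diff[OF D(1) d_grade[OF g(1)]])
    have udg': "u * d g' = 0"
      using d_d[of g] d_mult[OF u(1), of g'] u(2,4) by (simp add: dg)
    have dtu: "d t * u = 0"
      using square_odd_zero[OF u(1,2)] by (simp add: t(2) mult.assoc)
    have "\<exists>z\<in>grade (2 * n). d z = t * u * g' \<and> \<theta> (\<theta> z) = 0"
      by (rule less.IH[OF _ t(1) dtu g' udg']) (use False k u(3) in auto)
    then obtain z where z: "z \<in> grade (2 * n)" "d z = t * u * g'" "\<theta> (\<theta> z) = 0" by blast
    let ?z = "t * g - (-1) ^ (l + e - 1) * z"
    have "?z \<in> grade (2 * n)" using tg z(1) by (intro grade_diff grade_sign)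
    moreover have "d ?z = s * u * g"
      by (simp add: d_diff d_sign d_tg z(2) dg mult.assoc)
    moreover have "\<theta> (\<theta> ?z) = 0"
      by (simp add: linear_gca_diff[OF derivation_linear[OF \<theta>]] linear_gca_sign[OF derivation_linear[OF \<theta>]]
          \<theta>_tg z(3))
    ultimately show ?thesis by blast
  qed
qed

text \<open>The algebraic core: the space enters only through the vanishing of cohomology above
  degree \<open>n\<close>.\<close>

lemma gottlieb_monomial_cohomology:
  assumes x: "x \<in> grade (2 * n + 1)"
    and \<theta>: "derivation_cycle d (2 * n + 1) \<theta>" "\<theta> x = 1"
    and mono: "monomial_in_generators (d x)"
    and acyclic: "\<And>k a. n < k \<Longrightarrow> a \<in> grade k \<Longrightarrow> d a = 0 \<Longrightarrow> \<exists>y\<in>grade (k - 1). d y = a"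
  shows False
proof -
  let ?q = "2 * n + 1"
  have der: "derivation ?q \<theta>" and "d (\<theta> a) - (-1) ^ ?q * \<theta> (d a) = 0" for a
    using \<theta>(1) unfolding derivation_cycle_def by auto
  then have anti: "\<theta> (d a) = - d (\<theta> a)" for a
    by (simp add: eq_neg_iff_add_eq_0 add.commute)
  have no_cocycle: False if c: "c \<in> grade ?q" "d c = 0" "\<theta> c = 1" for c
  proof -
    obtain y where y: "y \<in> grade (?q - 1)" "d y = c" using acyclic[OF _ c(1,2)] by auto
    have "\<theta> y = 0" using derivation_low[OF der y(1)] by simp
    then show False using anti[of y] c(3) y(2) d_zero by simp
  qed
  \<comment> \<open>Both factors have degree below that of \<theta>, so \<theta> kills their product
    and still takes \<open>x - y * z\<close> to 1.\<close>
  have no_product: False if y: "y \<in> grade i" "z \<in> grade j" "i + j = ?q" "i < ?q" "j < ?q" "d x = d (y * z)"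
    for y z i j
  proof (rule no_cocycle)
    show "x - y * z \<in> grade ?q" using x grade_mult[OF y(1,2)] y(3) grade_diff by simp
    show "d (x - y * z) = 0" by (simp add: d_diff y(6))
    show "\<theta> (x - y * z) = 1"
      using derivation_mult[OF der y(1), of z] derivation_low[OF der y(1,4)] derivation_low[OF der y(2,5)] \<theta>(2)
      by (simp add: linear_gca_diff[OF derivation_linear[OF der]])
  qed
  obtain I e and u :: "nat \<Rightarrow> 'v free_gca" and js m where basis: "ordered_homogeneous_basis I e u"
    and js: "js \<noteq> []" "set js \<subseteq> I" "sorted_wrt (<) js"
      "\<forall>j\<in>set js. 1 \<le> m j \<and> (odd (e j) \<longrightarrow> m j = 1)"
    and dx: "d x = prod_list (map (\<lambda>j. u j ^ m j) js)"
    using mono unfolding monomial_in_generators_def by blast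
  obtain i js' where i: "js = i # js'" using js(1) by (cases js) auto
  have deg: "\<And>j. j \<in> I \<Longrightarrow> u j \<in> grade (e j)"
    using basis V_deg_grade unfolding ordered_homogeneous_basis_def by auto
  have iI: "i \<in> I" "1 \<le> m i" using js i by auto
  let ?u = "u i" and ?e = "e i"
  have u: "?u \<in> grade ?e" "2 \<le> ?e" using deg[OF iI(1)] basis_degree_ge2[OF basis iI(1)] .
  have du: "d ?u = 0"
    using first_generator_cocycle[OF basis js] d_d[of x] unfolding dx by (simp add: i)
  \<comment> \<open>Only one copy of the first generator is split off; the remaining
    \<open>m i - 1\<close> copies stay in \<open>p\<close>.\<close>
  define p where "p = ?u ^ (m i - 1) * prod_list (map (\<lambda>j. u j ^ m j) js')"
  define k where "k = (m i - 1) * ?e + (\<Sum>j\<leftarrow>js'. m j * e j)"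
  have p: "p \<in> grade k"
    unfolding p_def k_def using js(2) i deg
    by (intro grade_mult grade_power u(1) word_grade) auto
  have xp: "d x = ?u * p"
    using iI(2) unfolding dx i p_def by (cases "m i") (simp_all add: mult.assoc)
  have nz: "d x \<noteq> 0" using no_cocycle[OF x _ \<theta>(2)] by blast
  have ek: "?e + k = ?q + 1"
    using grade_unique[OF _ d_grade[OF x] nz] grade_mult[OF u(1) p] xp by simp
  obtain D where D: "derivation ?e D"
    and Du: "\<And>j. j \<in> I \<Longrightarrow> D (u j) = (if j = i then 1 else 0)"
    and Dd: "\<And>a k. a \<in> decomposables \<Longrightarrow> a \<in> grade k \<Longrightarrow> k \<le> ?e + 1 \<Longrightarrow> D a = 0"
    using dual_derivation[OF basis iI(1) finite_degree ge2] by blast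
  have Dui: "D ?u = 1" using Du iI(1) by simp
  \<comment> \<open>If \<open>k = 0\<close>, then \<open>D (d x) = p\<close>, because
    \<open>D\<close> kills \<open>p\<close> by degree; but \<open>D (d x) = 0\<close>, since
    \<open>d x\<close> is decomposable. This would give \<open>d x = 0\<close>.\<close>
  have k: "0 < k"
  proof (rule ccontr)
    assume k0: "\<not> 0 < k"
    then have "D (d x) = 0" using Dd[OF d_decomposable d_grade[OF x]] ek by simp
    moreover have "D p = 0" using derivation_low[OF D p] k0 u(2) by simp
    ultimately have "p = 0" using derivation_mult[OF D u(1), of p] xp Dui by simp
    then show False using nz xp by simp
  qed
  have udp: "?u * d p = 0" using d_d[of x] d_mult[OF u(1), of p] du unfolding xp
    by (cases "even ?e") auto
  show False
  proof (cases "even ?e")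
    case True
    have dp: "d p = 0"
      using even_nonzero_divisor[OF D u(1) Dui True _ d_grade[OF p], of 1] udp u(2) by simp
    show False
    \<comment> \<open>By \<open>ek\<close> the degrees of \<open>?u\<close> and \<open>p\<close> add
      up to \<open>2 * n + 2\<close>, so one of them exceeds \<open>n\<close>.\<close>
    proof (cases "n < ?e")
      case True
      obtain y where y: "y \<in> grade (?e - 1)" "d y = ?u" using acyclic[OF True u(1) du] by blast
      show False
        by (rule no_product[OF y(1) p])
          (use ek u(2) k d_mult[OF y(1), of p] y(2) dp xp in auto)
    next
      case False
      then have "n < k" using ek by simp
      then obtain y where y: "y \<in> grade (k - 1)" "d y = p" using acyclic[OF _ p dp] by blast
      show False
        by (rule no_product[OF u(1) y(1)])
          (use ek u(2) k d_mult[OF u(1), of y] y(2) du xp \<open>even ?e\<close> \<open>n < k\<close> in auto)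
    qed
  next
    case od: False
    have "d x * ?u = ?u * (p * ?u)" by (simp add: xp mult.assoc)
    also have "\<dots> = (-1) ^ (k * ?e) * (?u * ?u * p)"
      using graded_commutative[OF p u(1)] by (simp add: neg_one_power_mult qscale_mult_right mult.assoc)
    also have "\<dots> = 0" using square_odd_zero[OF u(1) od] by simp
    finally have dxu: "d x * ?u = 0" .
    \<comment> \<open>In \<open>odd_cocycle_primitive\<close> the parameter \<open>n\<close> becomes
      \<open>2 * n + 1\<close>, the degree of \<theta>, with \<open>s = x\<close> and
      \<open>g = p\<close>; the degree condition is \<open>ek\<close>.\<close>
    have "\<exists>z\<in>grade (2 * ?q). d z = x * ?u * p \<and> \<theta> (\<theta> z) = 0"
      by (rule odd_cocycle_primitive[OF u(1) od u(2) du D Dui Dd der _ x dxu p udp k])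
        (use ek u(2) acyclic in auto)
    then obtain z where z: "z \<in> grade (2 * ?q)" "d z = x * d x" "\<theta> (\<theta> z) = 0"
      by (auto simp: xp mult.assoc)
    have \<theta>dx: "\<theta> (d x) = 0" by (simp add: anti \<theta>(2) d_one)
    have \<theta>dz: "\<theta> (d z) = d x" using derivation_mult[OF der x, of "d x"] z(2) \<theta>dx \<theta>(2) by simp
    show False
    proof (rule no_cocycle)
      show "x + \<theta> z \<in> grade ?q"
        using x derivation_grade_diff[OF der z(1)] by (intro grade_add) simp_all
      show "d (x + \<theta> z) = 0" using anti[of z] \<theta>dz by (simp add: d_add)
      show "\<theta> (x + \<theta> z) = 1" using derivation_add[OF der] \<theta>(2) z(3) by simp
    qed
  qed
qed

end

section \<open>From the space to its model\<close>

text \<open>Vanishing leaves a single class in degree \<open>k\<close>, so injectivity of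
  \<open>\<Phi> k\<close> identifies the classes of \<open>a\<close> and 0. For \<open>0 < k\<close>
  the class of 0 is the image of \<open>d\<close>.\<close>

lemma model_cocycle_is_coboundary:
  assumes iso: "cohomology_iso d X \<Phi>" and lin: "d 0 = 0"
    and H: "\<not> nonzero_cohomology k X" and k: "0 < k" and a: "a \<in> grade k" "d a = 0"
  shows "\<exists>y\<in>grade (k - 1). d y = a"
proof -
  have bij: "bij_betw (\<Phi> k) (dga_cohomology d k) (cohomology k X)"
    using iso by (simp add: cohomology_iso_def)
  have B: "dga_coboundaries d k = d ` grade (k - 1)"
    using k by (cases k) (simp_all add: dga_coboundaries_def)
  have cls: "dga_class d k a \<in> dga_cohomology d k" "dga_class d k 0 \<in> dga_cohomology d k"
    using a lin grade_zero by (auto simp: dga_cohomology_def dga_cocycles_def)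
  have "\<Phi> k (dga_class d k a) = \<Phi> k (dga_class d k 0)"
    using bij_betwE[OF bij] cls H unfolding nonzero_cohomology_def by simp
  then have "dga_class d k a = dga_class d k 0"
    using inj_onD[OF bij_betw_imp_inj_on[OF bij]] cls by blast
  moreover have "a \<in> dga_class d k a"
    unfolding dga_class_def B elt_set_plus_def using lin grade_zero[of "k - 1"] by force
  ultimately have "a \<in> d ` grade (k - 1)"
    by (simp add: dga_class_def B elt_set_plus_def)
  then show ?thesis by blast
qed

theorem theorem3:
  fixes X :: "'a topology"
    and d :: "'v::graded_generators free_gca \<Rightarrow> 'v free_gca"
    and x :: "'v free_gca"
    and n N :: nat
  assumes "simply_connected_space X"
    and "finite_dimensional_cohomology X"
    and "N = Max {k. nonzero_cohomology k X}"
    and "sullivan_minimal_model d X"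
    and "gottlieb_element d (2 * n + 1) x"
    and "monomial_in_generators (d x)"
  shows "2 * n + 1 < 2 * N"
proof (rule ccontr)
  assume "\<not> 2 * n + 1 < 2 * N"
  \<comment> \<open>Parity: an odd number \<open>2 * n + 1\<close> that is at least
    \<open>2 * N\<close> forces \<open>n\<close> to be at least \<open>N\<close>.\<close>
  then have "N \<le> n" by simp
  have "minimal_sullivan_algebra d" and "\<exists>\<Phi>. cohomology_iso d X \<Phi>"
    using assms(4) unfolding sullivan_minimal_model_def by auto
  then obtain \<Phi> where iso: "cohomology_iso d X \<Phi>" by blast
  interpret minimal_algebra d by standard fact
  obtain \<theta> where \<theta>: "derivation_cycle d (2 * n + 1) \<theta>" "\<theta> x = 1" and x: "x \<in> V_deg (2 * n + 1)"
    using assms(5) unfolding gottlieb_element_def by blast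
  have "finite {k. nonzero_cohomology k X}"
    using assms(2) unfolding finite_dimensional_cohomology_def by blast
  then have "k \<le> N" if "nonzero_cohomology k X" for k
    unfolding assms(3) by (rule Max_ge) (simp add: that)
  then have "\<not> nonzero_cohomology k X" if "n < k" for k
    using that \<open>N \<le> n\<close> by fastforce
  then show False
    using gottlieb_monomial_cohomology[OF _ \<theta> assms(6)] x V_deg_grade
      model_cocycle_is_coboundary[OF iso d_zero] by (metis in_mono not_less0 gr0I)
qed

end
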